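(* Let $\Omega\subset\mathbb R^2$ be a smooth bounded domain, $\gamma\in[-1,1)$, $\sigma>0$, $\lambda>0$, and for $u\in H_0^1(\Omega)$ let $$J_\lambda(u)=\frac12\int_\Omega|\nabla u|^2\,dx-\lambda\ln\int_\Omega e^u\,dx-\lambda\sigma\ln\int_\Omega e^{\gamma u}\,dx.$$ For any fixed $a_0,d_0>0$ let $\mathcal A_{a_0,d_0}$ be the set of all $u\in H_0^1(\Omega)$ for which there exist (measurable) subsets $\Omega_1,\Omega_2\subset\Omega$ with $\mathrm{dist}(\Omega_1,\Omega_2)\ge d_0$ and $$\frac{\int_{\Omega_i}e^u\,dx}{\int_\Omega e^u\,dx}\ge a_0,\qquad i=1,2.$$ If $$\lambda<\frac{16\pi}{1+2\sigma\gamma^2},$$ then $J_\lambda$ is bounded from below on $\mathcal A_{a_0,d_0}$.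
   Context: $\mathrm{dist}(\Omega_1,\Omega_2)=\inf\{|x-y|:x\in\Omega_1,\ y\in\Omega_2\}$. *)

theory Defs
  imports "HOL-Analysis.Analysis"
begin

(* For open S: all iterated partial derivatives up to order k exist and are continuous on S. *)
primrec Ck_on :: "nat \<Rightarrow> 'a::euclidean_space set \<Rightarrow> ('a \<Rightarrow> real) \<Rightarrow> bool" where
  "Ck_on 0 S f \<longleftrightarrow> continuous_on S f"
| "Ck_on (Suc k) S f \<longleftrightarrow>
     (\<forall>x\<in>S. f differentiable (at x)) \<and>
     (\<forall>b\<in>Basis. Ck_on k S (\<lambda>x. frechet_derivative f (at x) b))"

definition smooth_on :: "'a::euclidean_space set \<Rightarrow> ('a \<Rightarrow> real) \<Rightarrow> bool" where
  "smooth_on S f \<longleftrightarrow> (\<forall>k. Ck_on k S f)"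

(* Near each boundary point, after an isometric change of coordinates, the domain is the
   part of a ball lying strictly above the graph of a smooth function. *)
definition smooth_bounded_domain :: "(real^2) set \<Rightarrow> bool" where
  "smooth_bounded_domain \<Omega> \<longleftrightarrow>
     \<Omega> \<noteq> {} \<and> open \<Omega> \<and> connected \<Omega> \<and> bounded \<Omega> \<and>
     (\<forall>p\<in>frontier \<Omega>. \<exists>r>0. \<exists>T :: real^2 \<Rightarrow> real^2. \<exists>g :: real \<Rightarrow> real.
        orthogonal_transformation T \<and> smooth_on UNIV g \<and>
        \<Omega> \<inter> ball p r = {x \<in> ball p r. g (T x $ 1) < T x $ 2})"

definition test_functions :: "(real^2) set \<Rightarrow> (real^2 \<Rightarrow> real) set" where
  "test_functions \<Omega> = {\<phi>. smooth_on UNIV \<phi> \<and>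
     compact (closure {x. \<phi> x \<noteq> 0}) \<and> closure {x. \<phi> x \<noteq> 0} \<subseteq> \<Omega>}"

definition grad :: "(real^2 \<Rightarrow> real) \<Rightarrow> real^2 \<Rightarrow> real^2" where
  "grad \<phi> x = (\<chi> i. frechet_derivative \<phi> (at x) (axis i 1))"

definition square_integrable ::
    "(real^2) set \<Rightarrow> (real^2 \<Rightarrow> 'b::{second_countable_topology, real_normed_vector}) \<Rightarrow> bool" where
  "square_integrable \<Omega> f \<longleftrightarrow>
     f \<in> borel_measurable (lebesgue_on \<Omega>) \<and> integrable (lebesgue_on \<Omega>) (\<lambda>x. (norm (f x))\<^sup>2)"

definition has_weak_gradient ::
    "(real^2) set \<Rightarrow> (real^2 \<Rightarrow> real) \<Rightarrow> (real^2 \<Rightarrow> real^2) \<Rightarrow> bool" where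
  "has_weak_gradient \<Omega> u G \<longleftrightarrow>
     square_integrable \<Omega> u \<and> square_integrable \<Omega> G \<and>
     (\<forall>\<phi>\<in>test_functions \<Omega>. \<forall>i.
        (\<integral>x. u x * (grad \<phi> x $ i) \<partial>lebesgue_on \<Omega>) = - (\<integral>x. (G x $ i) * \<phi> x \<partial>lebesgue_on \<Omega>))"

(* Sobolev functions are represented by functions on the plane whose values outside \<Omega>
   are irrelevant, without identifying functions that agree almost everywhere. *)
definition H1 :: "(real^2) set \<Rightarrow> (real^2 \<Rightarrow> real) set" where
  "H1 \<Omega> = {u. \<exists>G. has_weak_gradient \<Omega> u G}"

(* For open \<Omega>, weak gradients are unique up to null sets, so the choice does not affect integrals. *)
definition weak_gradient :: "(real^2) set \<Rightarrow> (real^2 \<Rightarrow> real) \<Rightarrow> real^2 \<Rightarrow> real^2" where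
  "weak_gradient \<Omega> u = (SOME G. has_weak_gradient \<Omega> u G)"

(* The closure of the test functions in the norm of H1; the classical gradient of a
   test function is a weak gradient of it. *)
definition H10 :: "(real^2) set \<Rightarrow> (real^2 \<Rightarrow> real) set" where
  "H10 \<Omega> = {u \<in> H1 \<Omega>. \<exists>\<phi> :: nat \<Rightarrow> real^2 \<Rightarrow> real.
     (\<forall>n. \<phi> n \<in> test_functions \<Omega>) \<and>
     (\<lambda>n. (\<integral>x. (u x - \<phi> n x)\<^sup>2 \<partial>lebesgue_on \<Omega>) +
           (\<integral>x. (norm (weak_gradient \<Omega> u x - grad (\<phi> n) x))\<^sup>2 \<partial>lebesgue_on \<Omega>))
       \<longlonglongrightarrow> 0}"

definition J :: "(real^2) set \<Rightarrow> real \<Rightarrow> real \<Rightarrow> real \<Rightarrow> (real^2 \<Rightarrow> real) \<Rightarrow> real" where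
  "J \<Omega> \<gamma> \<sigma> lam u =
     1/2 * (\<integral>x. (norm (weak_gradient \<Omega> u x))\<^sup>2 \<partial>lebesgue_on \<Omega>)
     - lam * ln (\<integral>x. exp (u x) \<partial>lebesgue_on \<Omega>)
     - lam * \<sigma> * ln (\<integral>x. exp (\<gamma> * u x) \<partial>lebesgue_on \<Omega>)"

(* setdist of an empty set is 0 rather than the infimum of the empty set, but the mass
   condition already excludes empty (indeed null) subsets when a0 > 0. *)
definition spread_class :: "(real^2) set \<Rightarrow> real \<Rightarrow> real \<Rightarrow> (real^2 \<Rightarrow> real) set" where
  "spread_class \<Omega> a0 d0 = {u \<in> H10 \<Omega>. \<exists>\<Omega>1 \<Omega>2.
     \<Omega>1 \<in> sets lebesgue \<and> \<Omega>2 \<in> sets lebesgue \<and> \<Omega>1 \<subseteq> \<Omega> \<and> \<Omega>2 \<subseteq> \<Omega> \<and>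
     setdist \<Omega>1 \<Omega>2 \<ge> d0 \<and>
     (\<integral>x. exp (u x) \<partial>lebesgue_on \<Omega>1) / (\<integral>x. exp (u x) \<partial>lebesgue_on \<Omega>) \<ge> a0 \<and>
     (\<integral>x. exp (u x) \<partial>lebesgue_on \<Omega>2) / (\<integral>x. exp (u x) \<partial>lebesgue_on \<Omega>) \<ge> a0}"

end

theory Submission
  imports Defs "HOL-Real_Asymp.Real_Asymp"
begin

text \<open>
  Everything rests on a dual form of the Trudinger-Moser inequality. Averaging over rays gives
  \<open>\<bar>f x\<bar> \<le> (1 / 2\<pi>) \<integral> \<bar>\<nabla>f y\<bar> / \<bar>x - y\<bar> dy\<close>. For sets \<open>S\<^sub>i\<close> with mutual distance at least \<open>d\<close> let
  \<open>Z\<^sub>i\<close> be the integral of \<open>e\<^sup>f\<close> over \<open>S\<^sub>i\<close>, let \<open>w\<^sub>i = e\<^sup>f / Z\<^sub>i\<close> on \<open>S\<^sub>i\<close>, and test the estimate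
  against \<open>w = \<Sum> w\<^sub>i\<close>. Young's inequality yields, for \<open>0 < t < 1\<close>,
  \<open>\<Sum> \<integral> f w\<^sub>i \<le> \<parallel>\<nabla>f\<parallel>\<^sup>2 / (16\<pi>t) + (t / \<pi>) \<integral>\<integral> w(x) w(x') K(x, x')\<close>, where the kernel
  \<open>K(x, x') = \<integral> dy / (\<bar>x - y\<bar> \<bar>x' - y\<bar>)\<close> is at most
  \<open>2\<pi>(1 + \<eta>) ln (1 / \<bar>x - x'\<bar>) + C\<close>. The interaction of different \<open>w\<^sub>i\<close> is bounded because of
  the separation, and the Gibbs variational principle bounds the self-interaction of \<open>w\<^sub>i\<close> by
  \<open>\<integral> f w\<^sub>i - ln Z\<^sub>i + C\<close>, the singularity \<open>\<bar>x - x'\<bar>\<close> to the power \<open>-(1 + t)\<close> being integrable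
  in the plane. Thus \<open>\<Sum> ln Z\<^sub>i \<le> \<parallel>\<nabla>f\<parallel>\<^sup>2 / (16\<pi>t) + C\<close>: one set gives the constant \<open>1 / 16\<pi>\<close> and two
  separated sets give \<open>1 / 32\<pi>\<close>, each up to an arbitrarily small loss. Fatou's lemma extends this
  to \<open>H\<^sub>0\<^sup>1\<close>. On the spread class, the two-set bound controls the term with \<open>e\<^sup>u\<close> and the
  one-set bound, applied to \<open>\<gamma>u\<close>, controls the other one.
\<close>

subsection \<open>Radial integrals in the plane\<close>

lemma emeasure_cball_plane: "r \<ge> 0 \<Longrightarrow> emeasure lborel (cball (x::real^2) r) = ennreal (pi * r\<^sup>2)"
  by (simp add: emeasure_cball unit_ball_vol_2)

text \<open>Polar coordinates for radial functions. The half-lines generate the Borel sets of the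
  line, so it suffices to compare disc areas with the integral of \<open>2 * pi * r\<close>.\<close>

lemma distr_norm_plane:
  "distr lborel borel (norm :: real^2 \<Rightarrow> real) =
     density lborel (\<lambda>r. ennreal (2 * pi * r) * indicator {0..} r)" (is "?M = ?N")
proof (rule measure_eqI_generator_eq[where E = "range atMost" and \<Omega> = UNIV and A = "\<lambda>n. {..real n}"])
  show "Int_stable (range (atMost :: real \<Rightarrow> _))"
    by (auto simp: Int_stable_def)
  have M: "emeasure ?M {..a} = (if a < 0 then 0 else ennreal (pi * a\<^sup>2))" for a
  proof -
    have "norm -` {..a} = cball (0::real^2) a" by auto
    then show ?thesis by (simp add: emeasure_distr emeasure_cball_plane del: emeasure_lborel_cball_finite)
  qed
  have N: "emeasure ?N {..a} = (if a < 0 then 0 else ennreal (pi * a\<^sup>2))" for a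
  proof -
    have "emeasure ?N {..a} = (\<integral>\<^sup>+r. ennreal (2 * pi * r) * indicator {0..a} r \<partial>lborel)"
      by (subst emeasure_density) (auto intro!: nn_integral_cong split: split_indicator)
    also have "\<dots> = (if a < 0 then 0 else ennreal (pi * a\<^sup>2))"
    proof (cases "a < 0")
      case False
      have "(\<integral>\<^sup>+r. ennreal (2 * pi * r) * indicator {0..a} r \<partial>lborel) = pi * a\<^sup>2 - pi * 0\<^sup>2"
        using False by (intro nn_integral_FTC_Icc) (auto intro!: derivative_eq_intros)
      then show ?thesis using False by simp
    qed simp
    finally show ?thesis .
  qed
  show "emeasure ?M X = emeasure ?N X" if "X \<in> range atMost" for X
    using that M N by auto
  show "emeasure ?M {..real n} \<noteq> \<infinity>" for n
    unfolding M by simp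
  show "sets ?M = sigma_sets UNIV (range atMost)" "sets ?N = sigma_sets UNIV (range atMost)"
    by (simp_all add: borel_eq_atMost)
  show "(\<Union>n. {..real n}) = UNIV"
    by (auto simp: real_arch_simple)
qed auto

lemma nn_integral_radial:
  fixes x :: "real^2"
  assumes [measurable]: "f \<in> borel_measurable borel"
  shows "(\<integral>\<^sup>+y. f (norm (x - y)) \<partial>lborel) = (\<integral>\<^sup>+r. ennreal (2 * pi * r) * indicator {0..} r * f r \<partial>lborel)"
proof -
  have "(\<integral>\<^sup>+y. f (norm (x - y)) \<partial>lborel) = (\<integral>\<^sup>+(y::real^2). f (norm y) \<partial>lborel)"
    by (subst lborel_affine[of "-1" x]) (simp_all add: nn_integral_density nn_integral_distr)
  also have "\<dots> = (\<integral>\<^sup>+r. f r \<partial>distr lborel borel (norm :: real^2 \<Rightarrow> real))"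
    by (simp add: nn_integral_distr)
  also have "\<dots> = (\<integral>\<^sup>+r. ennreal (2 * pi * r) * indicator {0..} r * f r \<partial>lborel)"
    unfolding distr_norm_plane by (simp add: nn_integral_density)
  finally show ?thesis .
qed

text \<open>Singularities of order below the dimension 2 are integrable. Exponent 1 serves the near
  part of the logarithmic kernel, exponent \<open>1 + t\<close> the Gibbs estimate.\<close>

lemma nn_integral_norm_powr:
  fixes x :: "real^2"
  assumes "R \<ge> 0" "p < 2"
  shows "(\<integral>\<^sup>+y. ennreal (norm (x - y) powr - p) * indicator (cball x R) y \<partial>lborel)
           = ennreal (2 * pi * R powr (2 - p) / (2 - p))"
proof -
  have "(\<integral>\<^sup>+y. ennreal (norm (x - y) powr - p) * indicator (cball x R) y \<partial>lborel)
      = (\<integral>\<^sup>+y. ennreal (norm (x - y) powr - p) * indicator {..R} (norm (x - y)) \<partial>lborel)"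
    by (intro nn_integral_cong) (auto split: split_indicator simp: dist_norm)
  also have "\<dots> = (\<integral>\<^sup>+r. ennreal (2 * pi * r) * indicator {0..} r * (ennreal (r powr - p) * indicator {..R} r) \<partial>lborel)"
    by (rule nn_integral_radial[where f = "\<lambda>r. ennreal (r powr - p) * indicator {..R} r"]) measurable
  also have "\<dots> = (\<integral>\<^sup>+r. ennreal (2 * pi) * (indicator {0..R} r * ennreal (r powr (1 - p))) \<partial>lborel)"
  proof (intro nn_integral_cong)
    fix r :: real
    \<comment> \<open>At \<open>r = 0\<close> both sides vanish, since \<open>0 powr a = 0\<close>
      for every exponent.\<close>
    have "r * r powr - p = r powr (1 - p)" if "r \<ge> 0"
      using that by (cases "r = 0") (auto simp: powr_diff powr_minus field_simps)
    then show "ennreal (2 * pi * r) * indicator {0..} r * (ennreal (r powr - p) * indicator {..R} r) =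
        ennreal (2 * pi) * (indicator {0..R} r * ennreal (r powr (1 - p)))"
      by (auto split: split_indicator simp: ennreal_mult'[symmetric] mult.assoc)
  qed
  also have "\<dots> = ennreal (2 * pi) * (\<integral>\<^sup>+r. indicator {0..R} r * (r powr (1 - p)) \<partial>lborel)"
    by (subst nn_integral_cmult) (auto simp: ennreal_mult' ennreal_indicator intro!: nn_integral_cong)
  also have "(\<integral>\<^sup>+r. indicator {0..R} r * (r powr (1 - p)) \<partial>lborel) = R powr (1 - p + 1) / (1 - p + 1)"
    using assms by (intro nn_integral_has_integral_lebesgue has_integral_powr_from_0) auto
  finally show ?thesis using assms by (simp add: ennreal_mult'[symmetric] add.commute)
qed

text \<open>The critical order 2 produces the logarithm of the kernel bound.\<close>

lemma nn_integral_norm_annulus: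
  fixes x :: "real^2"
  assumes "0 < a" "a \<le> R"
  shows "(\<integral>\<^sup>+y. ennreal (1 / (norm (x - y))\<^sup>2) * indicator {a..R} (norm (x - y)) \<partial>lborel)
           = ennreal (2 * pi * ln (R / a))"
proof -
  have "(\<integral>\<^sup>+y. ennreal (1 / (norm (x - y))\<^sup>2) * indicator {a..R} (norm (x - y)) \<partial>lborel)
      = (\<integral>\<^sup>+r. ennreal (2 * pi * r) * indicator {0..} r * (ennreal (1 / r\<^sup>2) * indicator {a..R} r) \<partial>lborel)"
    by (rule nn_integral_radial[where f = "\<lambda>r. ennreal (1 / r\<^sup>2) * indicator {a..R} r"]) measurable
  also have "\<dots> = (\<integral>\<^sup>+r. ennreal (2 * pi / r) * indicator {a..R} r \<partial>lborel)"
    using assms by (intro nn_integral_cong)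
      (auto split: split_indicator simp: ennreal_mult'[symmetric] power2_eq_square field_simps)
  also have "\<dots> = ennreal (2 * pi * ln R - 2 * pi * ln a)"
    using assms by (intro nn_integral_FTC_Icc) (auto intro!: derivative_eq_intros)
  finally show ?thesis using assms by (simp add: ln_div right_diff_distrib)
qed

subsection \<open>Bounding a function by the Riesz potential of its gradient\<close>

text \<open>This is the integral over the ray parameter that remains after the substitution in
  \<open>riesz_potential_bound\<close>.\<close>

lemma nn_integral_inverse_cube:
  assumes "a > 0"
  shows "(\<integral>\<^sup>+t. ennreal (1 / t ^ 3) * indicator {a..} t \<partial>lborel) = ennreal (1 / (2 * a\<^sup>2))"
proof -
  have "(\<integral>\<^sup>+t. ennreal (1 / t ^ 3) * indicator {a..} t \<partial>lborel) = 0 - (- 1 / (2 * a\<^sup>2))"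
  proof (rule nn_integral_FTC_atLeast)
    show "((\<lambda>t. - 1 / (2 * t\<^sup>2)) has_real_derivative 1 / t ^ 3) (at t)" if "a \<le> t" for t
      using assms that by (auto intro!: derivative_eq_intros simp: power2_eq_square power3_eq_cube field_simps)
    show "((\<lambda>t::real. - 1 / (2 * t\<^sup>2)) \<longlongrightarrow> 0) at_top"
      by real_asymp
  qed (use assms in auto)
  then show ?thesis by simp
qed

text \<open>The fundamental theorem of calculus is applied along the ray from \<open>x\<close> in
  direction \<open>z\<close>, up to a point where \<open>f\<close> vanishes.\<close>

lemma nn_integral_ray_le:
  fixes f :: "real^2 \<Rightarrow> real" and g :: "real^2 \<Rightarrow> real^2"
  assumes deriv: "\<And>x. (f has_derivative (\<lambda>h. g x \<bullet> h)) (at x)"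
    and cont: "continuous_on UNIV g"
    and supp: "bounded {x. f x \<noteq> 0}"
    and "z \<noteq> 0"
  shows "ennreal \<bar>f x\<bar> \<le> (\<integral>\<^sup>+t. ennreal (norm (g (x + t *\<^sub>R z)) * norm z) * indicator {0<..} t \<partial>lborel)"
proof -
  obtain B where B: "\<And>x. f x \<noteq> 0 \<Longrightarrow> norm x \<le> B"
    using supp by (auto simp: bounded_iff)
  \<comment> \<open>The length of \<open>T *\<^sub>R z\<close> is
    \<open>\<bar>B\<bar> + norm x + 1\<close>, enough to leave the ball of radius \<open>B\<close>
    from any starting point \<open>x\<close>.\<close>
  define T where "T = (\<bar>B\<bar> + norm x + 1) / norm z"
  have "T > 0" using \<open>z \<noteq> 0\<close> by (auto simp: T_def add_nonneg_pos)
  have "norm (x + T *\<^sub>R z) \<ge> norm (T *\<^sub>R z) - norm x"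
    by (metis add.commute norm_diff_ineq)
  then have "norm (x + T *\<^sub>R z) > B"
    using \<open>z \<noteq> 0\<close> \<open>T > 0\<close> by (auto simp: T_def abs_of_pos)
  then have fT: "f (x + T *\<^sub>R z) = 0" using B by force
  have cg: "continuous_on A (\<lambda>t. g (x + t *\<^sub>R z))" for A :: "real set"
    by (intro continuous_on_compose2[OF cont] continuous_intros) auto
  have "((\<lambda>t. g (x + t *\<^sub>R z) \<bullet> z) has_integral (f (x + T *\<^sub>R z) - f (x + 0 *\<^sub>R z))) {0..T}"
  proof (rule fundamental_theorem_of_calculus)
    fix t assume "t \<in> {0..T}"
    have "((\<lambda>t. f (x + t *\<^sub>R z)) has_derivative (\<lambda>s. g (x + t *\<^sub>R z) \<bullet> (s *\<^sub>R z))) (at t within {0..T})"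
      by (rule has_derivative_compose[OF _ deriv]) (auto intro!: derivative_eq_intros)
    then show "((\<lambda>t. f (x + t *\<^sub>R z)) has_vector_derivative g (x + t *\<^sub>R z) \<bullet> z) (at t within {0..T})"
      by (simp add: has_vector_derivative_def)
  qed (use \<open>T > 0\<close> in simp)
  then have 1: "integral {0..T} (\<lambda>t. g (x + t *\<^sub>R z) \<bullet> z) = - f x"
    using fT by (simp add: integral_unique)
  have int: "(\<lambda>t. norm (g (x + t *\<^sub>R z)) * norm z) integrable_on {0..T}"
    by (intro integrable_continuous_interval continuous_intros cg)
  have "norm (integral {0..T} (\<lambda>t. g (x + t *\<^sub>R z) \<bullet> z)) \<le> integral {0..T} (\<lambda>t. norm (g (x + t *\<^sub>R z)) * norm z)"
    by (intro integral_norm_bound_integral int)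
      (auto intro!: integrable_continuous_interval continuous_intros cg Cauchy_Schwarz_ineq2)
  then have "ennreal \<bar>f x\<bar> \<le> ennreal (integral {0..T} (\<lambda>t. norm (g (x + t *\<^sub>R z)) * norm z))"
    using 1 by (intro ennreal_leI) simp
  also have "\<dots> = (\<integral>\<^sup>+t. indicator {0..T} t * (norm (g (x + t *\<^sub>R z)) * norm z) \<partial>lborel)"
    using integrable_integral[OF int] by (intro nn_integral_has_integral_lebesgue[symmetric]) simp_all
  \<comment> \<open>The two parameter ranges differ at 0, which is a null set; \<open>t = 0\<close>
    is left out to suit the substitution made later.\<close>
  also have "\<dots> \<le> (\<integral>\<^sup>+t. ennreal (norm (g (x + t *\<^sub>R z)) * norm z) * indicator {0<..} t \<partial>lborel)"
    by (rule nn_integral_mono_AE, rule AE_mp[OF AE_lborel_singleton[of "0::real"] AE_I2])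
      (simp add: indicator_def)
  finally show ?thesis .
qed

text \<open>The ray estimate is averaged over directions in the unit disc; the substitution \<open>y = x + tz\<close>
  then replaces polar coordinates.\<close>

lemma riesz_potential_bound:
  fixes f :: "real^2 \<Rightarrow> real" and g :: "real^2 \<Rightarrow> real^2"
  assumes deriv: "\<And>x. (f has_derivative (\<lambda>h. g x \<bullet> h)) (at x)"
    and cont: "continuous_on UNIV g"
    and supp: "bounded {x. f x \<noteq> 0}"
  shows "ennreal \<bar>f x\<bar> \<le> (\<integral>\<^sup>+y. ennreal (norm (g y) / (2 * pi * norm (x - y))) \<partial>lborel)"
proof -
  have [measurable]: "g \<in> borel_measurable borel"
    using cont by (simp add: borel_measurable_continuous_onI)
  let ?B = "cball (0::real^2) 1"
  \<comment> \<open>The left side of the ray estimate does not depend on \<open>z\<close>, so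
    integration over the unit disc multiplies it by the area \<open>pi\<close>.\<close>
  have "ennreal pi * ennreal \<bar>f x\<bar> = (\<integral>\<^sup>+z. ennreal \<bar>f x\<bar> * indicator ?B z \<partial>lborel)"
    by (subst nn_integral_cmult_indicator) (auto simp: emeasure_cball_plane mult.commute)
  also have "\<dots> = (\<integral>\<^sup>+(z::real^2). ennreal \<bar>f x\<bar> * indicator {..1} (norm z) \<partial>lborel)"
    by (intro nn_integral_cong) (simp add: indicator_def)
  also have "\<dots> \<le> (\<integral>\<^sup>+z. (\<integral>\<^sup>+t. ennreal (norm (g (x + t *\<^sub>R z)) * norm z) * indicator {0<..} t \<partial>lborel) * indicator {..1} (norm z) \<partial>lborel)"
    using nn_integral_ray_le[OF deriv cont supp]
    by (intro nn_integral_mono_AE AE_mp[OF AE_lborel_singleton[of 0] AE_I2] impI mult_right_mono) simp_all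
  also have "\<dots> = (\<integral>\<^sup>+z. \<integral>\<^sup>+t. ennreal (norm (g (x + t *\<^sub>R z)) * norm z) * indicator {0<..} t * indicator {..1} (norm z) \<partial>lborel \<partial>lborel)"
    by (intro nn_integral_cong nn_integral_multc[symmetric]) measurable
  also have "\<dots> = (\<integral>\<^sup>+t. \<integral>\<^sup>+z. ennreal (norm (g (x + t *\<^sub>R z)) * norm z) * indicator {0<..} t * indicator {..1} (norm z) \<partial>lborel \<partial>lborel)"
    by (rule lborel_pair.Fubini') measurable
  \<comment> \<open>With \<open>y = x + t z\<close> the Jacobian contributes
    \<open>1 / t\<^sup>2\<close> and \<open>norm z = norm (x - y) / t\<close> one more factor
    \<open>1 / t\<close>. The condition \<open>norm z \<le> 1\<close> becomes
    \<open>norm (x - y) \<le> t\<close>, written as a sign condition on the difference so that joint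
    measurability is automatic.\<close>
  also have "\<dots> = (\<integral>\<^sup>+t. \<integral>\<^sup>+y. ennreal (norm (g y) * norm (x - y)) * (ennreal (1 / t ^ 3) * indicator {0..} (t - norm (x - y))) \<partial>lborel \<partial>lborel)"
  proof (rule nn_integral_cong_AE, rule AE_mp[OF AE_lborel_singleton[of "0::real"] AE_I2], rule impI)
    fix t :: real
    assume "t \<noteq> 0"
    show "(\<integral>\<^sup>+z. ennreal (norm (g (x + t *\<^sub>R z)) * norm z) * indicator {0<..} t * indicator {..1} (norm z) \<partial>lborel)
       = (\<integral>\<^sup>+y. ennreal (norm (g y) * norm (x - y)) * (ennreal (1 / t ^ 3) * indicator {0..} (t - norm (x - y))) \<partial>lborel)"
    proof (cases "t > 0")
      case False
      then have "\<not> norm (x - y) \<le> t" for y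
        using \<open>t \<noteq> 0\<close> norm_ge_zero[of "x - y"] by linarith
      then show ?thesis using False by simp
    next
      case True
      let ?F = "\<lambda>y. ennreal (norm (g y) * norm (x - y)) * (ennreal (1 / t ^ 3) * indicator {0..} (t - norm (x - y)))"
      have [measurable]: "?F \<in> borel_measurable borel"
        by measurable
      have "(\<integral>\<^sup>+y. ?F y \<partial>lborel) = (\<integral>\<^sup>+z. ennreal (t\<^sup>2) * ?F (x + t *\<^sub>R z) \<partial>lborel)"
        using True by (subst lborel_affine[of t x]) (simp_all add: nn_integral_density nn_integral_distr)
      also have "\<dots> = (\<integral>\<^sup>+z. ennreal (norm (g (x + t *\<^sub>R z)) * norm z) * indicator {0<..} t * indicator {..1} (norm z) \<partial>lborel)"
      proof (intro nn_integral_cong)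
        fix z
        have "norm (t *\<^sub>R z) \<le> t \<longleftrightarrow> norm z \<le> 1" "t\<^sup>2 * (norm (g (x + t *\<^sub>R z)) * norm (t *\<^sub>R z) * (1 / t ^ 3)) = norm (g (x + t *\<^sub>R z)) * norm z"
          using True by (simp_all add: power2_eq_square power3_eq_cube)
        then show "ennreal (t\<^sup>2) * ?F (x + t *\<^sub>R z) =
            ennreal (norm (g (x + t *\<^sub>R z)) * norm z) * indicator {0<..} t * indicator {..1} (norm z)"
          using True by (simp add: ennreal_mult'[symmetric] indicator_def)
      qed
      finally show ?thesis ..
    qed
  qed
  also have "\<dots> = (\<integral>\<^sup>+y. \<integral>\<^sup>+t. ennreal (norm (g y) * norm (x - y)) * (ennreal (1 / t ^ 3) * indicator {0..} (t - norm (x - y))) \<partial>lborel \<partial>lborel)"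
    by (rule lborel_pair.Fubini') measurable
  also have "\<dots> = (\<integral>\<^sup>+y. ennreal (norm (g y) * norm (x - y)) * (\<integral>\<^sup>+t. ennreal (1 / t ^ 3) * indicator {0..} (t - norm (x - y)) \<partial>lborel) \<partial>lborel)"
    by (intro nn_integral_cong nn_integral_cmult) measurable
  also have "\<dots> = (\<integral>\<^sup>+y. ennreal pi * ennreal (norm (g y) / (2 * pi * norm (x - y))) \<partial>lborel)"
  proof (intro nn_integral_cong)
    fix y
    have *: "(\<integral>\<^sup>+t. ennreal (1 / t ^ 3) * indicator {0..} (t - norm (x - y)) \<partial>lborel)
        = (\<integral>\<^sup>+t. ennreal (1 / t ^ 3) * indicator {norm (x - y)..} t \<partial>lborel)"
      by (intro nn_integral_cong) (simp add: indicator_def)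
    show "ennreal (norm (g y) * norm (x - y)) * (\<integral>\<^sup>+t. ennreal (1 / t ^ 3) * indicator {0..} (t - norm (x - y)) \<partial>lborel)
       = ennreal pi * ennreal (norm (g y) / (2 * pi * norm (x - y)))"
    \<comment> \<open>For \<open>x = y\<close> both sides are 0, the right one because division by 0
      yields 0.\<close>
    proof (cases "x = y")
      case False
      then show ?thesis
        unfolding * by (subst nn_integral_inverse_cube)
          (simp_all add: ennreal_mult'[symmetric] power2_eq_square)
    qed simp
  qed
  also have "\<dots> = ennreal pi * (\<integral>\<^sup>+y. ennreal (norm (g y) / (2 * pi * norm (x - y))) \<partial>lborel)"
    by (rule nn_integral_cmult) measurable
  finally show ?thesis
    by (subst (asm) ennreal_mult_le_mult_iff) auto
qed

subsection \<open>The logarithmic kernel\<close>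

text \<open>Over the whole plane this integral would diverge logarithmically at infinity. The
  restriction to \<open>\<Omega>\<close> is possible because the gradient in
  \<open>pairing_le\<close> vanishes outside.\<close>

definition log_kernel :: "(real^2) set \<Rightarrow> real^2 \<Rightarrow> real^2 \<Rightarrow> ennreal" where
  "log_kernel \<Omega> x x' = (\<integral>\<^sup>+y. ennreal (1 / (norm (x - y) * norm (x' - y))) * indicator \<Omega> y \<partial>lborel)"

lemma borel_measurable_log_kernel [measurable]:
  assumes [measurable]: "\<Omega> \<in> sets borel" "f \<in> borel_measurable M" "g \<in> borel_measurable M"
  shows "(\<lambda>x. log_kernel \<Omega> (f x) (g x)) \<in> borel_measurable M"
  unfolding log_kernel_def by measurable

lemma nn_integral_inverse_norm:
  fixes x :: "real^2"
  assumes "R \<ge> 0"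
  shows "(\<integral>\<^sup>+y. ennreal (1 / norm (x - y)) * indicator (cball x R) y \<partial>lborel) = ennreal (2 * pi * R)"
  using nn_integral_norm_powr[OF assms, of 1 x] assms
  by (simp add: powr_minus inverse_eq_divide)

text \<open>Write a and b for the distances of \<open>y\<close> to \<open>x\<close> and
  \<open>x'\<close>, and split at a = \<open>M * d\<close>. Near \<open>x\<close>, the triangle
  inequality d <= a + b gives 1/(ab) <= (1/a + 1/b)/d. Far away a and b are comparable up to the
  factor \<open>1 + \<eta>\<close>, so the kernel is at most \<open>1 + \<eta>\<close> times
  1/a^2.\<close>

lemma log_kernel_pointwise:
  fixes x x' y :: "real^2"
  assumes "x \<noteq> x'" and "\<eta> > 0" and y: "y \<in> cball x R"
  defines "d \<equiv> norm (x - x')" and "M \<equiv> 1 + 1 / \<eta>"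
  shows "1 / (norm (x - y) * norm (x' - y))
    \<le> 1 / d * (1 / norm (x - y) * indicator (cball x (M * d)) y
            + 1 / norm (x' - y) * indicator (cball x' ((M + 1) * d)) y)
      + (1 + \<eta>) * (1 / (norm (x - y))\<^sup>2 * indicator {M * d..R} (norm (x - y)))"
proof -
  let ?a = "norm (x - y)" and ?b = "norm (x' - y)"
  have d: "d > 0" and M: "M > 1" using assms by auto
  have tri: "d \<le> ?a + ?b" "?b \<le> ?a + d" "?a \<le> ?b + d"
    unfolding d_def using norm_triangle_ineq4[of "x - y" "x' - y"]
      norm_triangle_ineq4[of "x - y" "x - x'"] norm_triangle_ineq[of "x - x'" "x' - y"] by auto
  consider "?a = 0 \<or> ?b = 0" | "?a > 0" "?b > 0" "?a \<le> M * d" | "?a > 0" "?b > 0" "?a > M * d"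
    using norm_ge_zero[of "x - y"] norm_ge_zero[of "x' - y"] by linarith
  then show ?thesis
  proof cases
    case 1
    \<comment> \<open>At the two singular points the convention for division by 0 makes the left
      side vanish.\<close>
    then have "1 / (?a * ?b) = 0" by auto
    then show ?thesis using d \<open>\<eta> > 0\<close> by (auto intro!: add_nonneg_nonneg mult_nonneg_nonneg)
  next
    case 2
    then have "?b \<le> (M + 1) * d" using tri by (simp add: algebra_simps)
    then have "y \<in> cball x' ((M + 1) * d)" "y \<in> cball x (M * d)"
      using 2 by (simp_all add: dist_norm)
    moreover have "1 / (?a * ?b) \<le> 1 / d * (1 / ?a + 1 / ?b)"
      using 2 d tri(1) by (simp add: field_simps)
    ultimately show ?thesis using \<open>\<eta> > 0\<close> by (auto intro!: add_increasing2)
  next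
    case 3
    have "(1 + \<eta>) * ?b \<ge> (1 + \<eta>) * (?a - d)"
      using tri \<open>\<eta> > 0\<close> by (intro mult_left_mono) auto
    \<comment> \<open>\<open>M = 1 + 1 / \<eta>\<close> is the threshold for which this follows from
      \<open>?a > M * d\<close>.\<close>
    moreover have "(1 + \<eta>) * d \<le> \<eta> * ?a"
    proof -
      have "\<eta> * (M * d) \<le> \<eta> * ?a" using 3 \<open>\<eta> > 0\<close> by (intro mult_left_mono) auto
      moreover have "\<eta> * (M * d) = (1 + \<eta>) * d" using \<open>\<eta> > 0\<close> by (simp add: M_def field_simps)
      ultimately show ?thesis by simp
    qed
    ultimately have "?a \<le> (1 + \<eta>) * ?b" by (simp add: algebra_simps)
    then have "1 / (?a * ?b) \<le> (1 + \<eta>) * (1 / ?a\<^sup>2)"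
      using 3 by (simp add: field_simps power2_eq_square)
    moreover have "?a \<in> {M * d..R}" using 3 y by (simp add: dist_norm)
    ultimately show ?thesis using d by (auto intro!: add_increasing)
  qed
qed

lemma ennreal_mult_indicator: "a \<ge> 0 \<Longrightarrow> ennreal (a * indicator A x) = ennreal a * indicator A x"
  by (simp add: indicator_def)

text \<open>Integrating the splitting, the two discs contribute multiples of d that cancel the
  factor 1/d and leave \<open>2 * pi * (2 * M + 1)\<close>, which is the additive constant. The
  annulus gives the logarithm.\<close>

lemma log_kernel_le:
  fixes x x' :: "real^2"
  assumes "\<Omega> \<subseteq> cball x R" and "x \<noteq> x'" and "norm (x - x') \<le> R" and "\<eta> > 0"
  shows "log_kernel \<Omega> x x' \<le> ennreal (2 * pi * (1 + \<eta>) * ln (R / norm (x - x')) + 2 * pi * (3 + 2 / \<eta>))"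
proof -
  define d where "d = norm (x - x')"
  define M where "M = 1 + 1 / \<eta>"
  have d: "d > 0" "d \<le> R" and M: "M > 1" using assms by (auto simp: d_def M_def)
  define f1 :: "real^2 \<Rightarrow> ennreal" where "f1 = (\<lambda>y. ennreal (1 / norm (x - y)) * indicator (cball x (M * d)) y)"
  define f2 :: "real^2 \<Rightarrow> ennreal" where "f2 = (\<lambda>y. ennreal (1 / norm (x' - y)) * indicator (cball x' ((M + 1) * d)) y)"
  define f3 :: "real^2 \<Rightarrow> ennreal" where "f3 = (\<lambda>y. ennreal (1 / (norm (x - y))\<^sup>2) * indicator {M * d..R} (norm (x - y)))"
  note f_defs = f1_def f2_def f3_def
  have [measurable]: "f1 \<in> borel_measurable borel" "f2 \<in> borel_measurable borel" "f3 \<in> borel_measurable borel"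
    unfolding f_defs by (auto intro!: borel_measurable_times_ennreal borel_measurable_indicator)
  have "log_kernel \<Omega> x x' \<le> (\<integral>\<^sup>+y. ennreal (1 / d) * (f1 y + f2 y) + ennreal (1 + \<eta>) * f3 y \<partial>lborel)"
    unfolding log_kernel_def
  proof (rule nn_integral_mono)
    fix y
    show "ennreal (1 / (norm (x - y) * norm (x' - y))) * indicator \<Omega> y
      \<le> ennreal (1 / d) * (f1 y + f2 y) + ennreal (1 + \<eta>) * f3 y"
    proof (cases "y \<in> \<Omega>")
      case True
      then have "y \<in> cball x R" using assms(1) by auto
      from ennreal_leI[OF log_kernel_pointwise[OF assms(2,4) this], folded d_def M_def]
      show ?thesis using True d \<open>\<eta> > 0\<close>
        by (simp add: f_defs ennreal_plus ennreal_mult ennreal_indicator ennreal_mult_indicator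
            del: times_divide_eq_right times_divide_eq_left mult_1_left)
    qed simp
  qed
  also have "\<dots> = ennreal (1 / d) * ((\<integral>\<^sup>+y. f1 y \<partial>lborel) + (\<integral>\<^sup>+y. f2 y \<partial>lborel)) + ennreal (1 + \<eta>) * (\<integral>\<^sup>+y. f3 y \<partial>lborel)"
    by (simp add: nn_integral_add nn_integral_cmult del: ennreal_plus)
  also have "\<dots> = ennreal (1 / d) * (ennreal (2 * pi * (M * d)) + ennreal (2 * pi * ((M + 1) * d))) + ennreal (1 + \<eta>) * (\<integral>\<^sup>+y. f3 y \<partial>lborel)"
    using d M unfolding f_defs by (simp add: nn_integral_inverse_norm del: times_divide_eq_left)
  also have "\<dots> \<le> ennreal (1 / d) * (ennreal (2 * pi * (M * d)) + ennreal (2 * pi * ((M + 1) * d))) + ennreal (1 + \<eta>) * ennreal (2 * pi * ln (R / d))"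
  proof (intro add_left_mono mult_left_mono)
    show "(\<integral>\<^sup>+y. f3 y \<partial>lborel) \<le> ennreal (2 * pi * ln (R / d))"
    \<comment> \<open>If \<open>M * d\<close> exceeds \<open>R\<close> the annulus is empty.
      Otherwise \<open>M > 1\<close> only decreases the logarithm.\<close>
    proof (cases "M * d \<le> R")
      case True
      then have "(\<integral>\<^sup>+y. f3 y \<partial>lborel) = ennreal (2 * pi * ln (R / (M * d)))"
        unfolding f_defs using d M by (intro nn_integral_norm_annulus) auto
      also have "\<dots> \<le> ennreal (2 * pi * ln (R / d))"
        using d M by (intro ennreal_leI mult_left_mono) (auto simp: ln_div ln_mult)
      finally show ?thesis .
    qed (simp add: f_defs)
  qed simp
  also have "\<dots> = ennreal (1 / d * (2 * pi * (M * d) + 2 * pi * ((M + 1) * d)) + (1 + \<eta>) * (2 * pi * ln (R / d)))"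
    using d M \<open>\<eta> > 0\<close> by (simp add: ennreal_plus[symmetric] ennreal_mult'[symmetric] del: ennreal_plus times_divide_eq_left)
  also have "1 / d * (2 * pi * (M * d) + 2 * pi * ((M + 1) * d)) = 2 * pi * (3 + 2 / \<eta>)"
    using d by (simp add: M_def field_simps)
  finally show ?thesis
    by (simp add: d_def algebra_simps)
qed

section \<open>Pairing with a density by Young's inequality\<close>

lemma ennreal_young:
  assumes "a \<ge> 0" "t > 0"
  shows "ennreal (a / (2 * pi)) * W \<le> ennreal (1 / (16 * pi * t)) * ennreal (a\<^sup>2) + ennreal (t / pi) * (W * W)"
proof (cases W)
  case (real r)
  \<comment> \<open>Completing the square: the weight 4t makes the mixed term equal to
    \<open>a * r / (2 * pi)\<close> and leaves the coefficient \<open>1 / (16 * pi * t)\<close> for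
    the energy.\<close>
  have "0 \<le> (a - 4 * t * r)\<^sup>2 / (16 * pi * t)" using assms by simp
  also have "\<dots> = 1 / (16 * pi * t) * a\<^sup>2 + t / pi * (r * r) - a / (2 * pi) * r"
    using assms by (simp add: field_simps power2_eq_square)
  finally have "ennreal (a / (2 * pi) * r) \<le> ennreal (1 / (16 * pi * t) * a\<^sup>2 + t / pi * (r * r))"
    by (intro ennreal_leI) simp
  then show ?thesis
    using assms real by (simp add: ennreal_mult[symmetric] ennreal_plus[symmetric] del: ennreal_plus)
next
  case top
  then show ?thesis using assms by (simp add: ennreal_mult_top ennreal_top_mult)
qed

text \<open>Exchanging integrals moves the Riesz potential from the gradient to \<open>w\<close>,
  with potential \<open>W\<close>. Young's inequality separates the energy from the integral of the
  square of \<open>W\<close>, and writing out that square gives the double integral against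
  \<open>log_kernel\<close>.\<close>

lemma pairing_le:
  fixes f :: "real^2 \<Rightarrow> real" and g :: "real^2 \<Rightarrow> real^2" and w :: "real^2 \<Rightarrow> ennreal"
  assumes deriv: "\<And>x. (f has_derivative (\<lambda>h. g x \<bullet> h)) (at x)"
    and cont: "continuous_on UNIV g"
    and supp: "bounded {x. f x \<noteq> 0}"
    and g0: "\<And>x. x \<notin> \<Omega> \<Longrightarrow> g x = 0"
    and [measurable]: "\<Omega> \<in> sets borel" "w \<in> borel_measurable borel"
    and "t > 0"
  shows "(\<integral>\<^sup>+x. ennreal \<bar>f x\<bar> * w x \<partial>lborel)
    \<le> ennreal (1 / (16 * pi * t)) * (\<integral>\<^sup>+y. ennreal ((norm (g y))\<^sup>2) \<partial>lborel)
      + ennreal (t / pi) * (\<integral>\<^sup>+x. w x * (\<integral>\<^sup>+x'. w x' * log_kernel \<Omega> x x' \<partial>lborel) \<partial>lborel)"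
proof -
  have [measurable]: "g \<in> borel_measurable borel"
    using cont by (simp add: borel_measurable_continuous_onI)
  define W where "W y = (\<integral>\<^sup>+x. w x * ennreal (1 / norm (x - y)) \<partial>lborel)" for y
  have [measurable]: "W \<in> borel_measurable borel"
    unfolding W_def by measurable
  have "(\<integral>\<^sup>+x. ennreal \<bar>f x\<bar> * w x \<partial>lborel)
     \<le> (\<integral>\<^sup>+x. (\<integral>\<^sup>+y. ennreal (norm (g y) / (2 * pi * norm (x - y))) \<partial>lborel) * w x \<partial>lborel)"
    by (intro nn_integral_mono mult_right_mono riesz_potential_bound[OF deriv cont supp]) simp
  also have "\<dots> = (\<integral>\<^sup>+x. \<integral>\<^sup>+y. ennreal (norm (g y) / (2 * pi * norm (x - y))) * w x \<partial>lborel \<partial>lborel)"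
    by (intro nn_integral_cong nn_integral_multc[symmetric]) measurable
  also have "\<dots> = (\<integral>\<^sup>+y. \<integral>\<^sup>+x. ennreal (norm (g y) / (2 * pi * norm (x - y))) * w x \<partial>lborel \<partial>lborel)"
    by (rule lborel_pair.Fubini') measurable
  also have "\<dots> = (\<integral>\<^sup>+y. \<integral>\<^sup>+x. ennreal (norm (g y) / (2 * pi)) * (w x * ennreal (1 / norm (x - y))) \<partial>lborel \<partial>lborel)"
    by (intro nn_integral_cong) (simp add: ennreal_mult[symmetric] mult.left_commute[of "ennreal _" "w _"] mult.commute[of _ "w _"])
  also have "\<dots> = (\<integral>\<^sup>+y. ennreal (norm (g y) / (2 * pi)) * W y \<partial>lborel)"
    unfolding W_def by (intro nn_integral_cong nn_integral_cmult) measurable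
  \<comment> \<open>Outside \<open>\<Omega>\<close> the left side is 0, so the square of
    \<open>W\<close> is needed only on \<open>\<Omega>\<close>.\<close>
  also have "\<dots> \<le> (\<integral>\<^sup>+y. ennreal (1 / (16 * pi * t)) * ennreal ((norm (g y))\<^sup>2) + ennreal (t / pi) * (W y * W y * indicator \<Omega> y) \<partial>lborel)"
  proof (rule nn_integral_mono)
    fix y
    show "ennreal (norm (g y) / (2 * pi)) * W y \<le> ennreal (1 / (16 * pi * t)) * ennreal ((norm (g y))\<^sup>2) + ennreal (t / pi) * (W y * W y * indicator \<Omega> y)"
      using ennreal_young[OF norm_ge_zero \<open>t > 0\<close>, of "g y" "W y"] g0[of y] by (cases "y \<in> \<Omega>") auto
  qed
  also have "\<dots> = ennreal (1 / (16 * pi * t)) * (\<integral>\<^sup>+y. ennreal ((norm (g y))\<^sup>2) \<partial>lborel) + ennreal (t / pi) * (\<integral>\<^sup>+y. W y * W y * indicator \<Omega> y \<partial>lborel)"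
    by (simp add: nn_integral_add nn_integral_cmult)
  also have "(\<integral>\<^sup>+y. W y * W y * indicator \<Omega> y \<partial>lborel)
    = (\<integral>\<^sup>+y. \<integral>\<^sup>+x. w x * ennreal (1 / norm (x - y)) * (W y * indicator \<Omega> y) \<partial>lborel \<partial>lborel)"
    by (subst nn_integral_multc) (simp_all add: W_def mult.assoc)
  also have "\<dots> = (\<integral>\<^sup>+x. \<integral>\<^sup>+y. w x * ennreal (1 / norm (x - y)) * (W y * indicator \<Omega> y) \<partial>lborel \<partial>lborel)"
    by (rule lborel_pair.Fubini') measurable
  also have "\<dots> = (\<integral>\<^sup>+x. w x * (\<integral>\<^sup>+y. ennreal (1 / norm (x - y)) * (W y * indicator \<Omega> y) \<partial>lborel) \<partial>lborel)"
    by (subst nn_integral_cmult[symmetric]) (simp_all add: mult.assoc)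
  also have "\<dots> = (\<integral>\<^sup>+x. w x * (\<integral>\<^sup>+x'. w x' * log_kernel \<Omega> x x' \<partial>lborel) \<partial>lborel)"
  proof (rule nn_integral_cong, rule arg_cong[where f = "(*) _"])
    fix x
    have "(\<integral>\<^sup>+y. ennreal (1 / norm (x - y)) * (W y * indicator \<Omega> y) \<partial>lborel)
      = (\<integral>\<^sup>+y. \<integral>\<^sup>+x'. w x' * (ennreal (1 / (norm (x - y) * norm (x' - y))) * indicator \<Omega> y) \<partial>lborel \<partial>lborel)"
    proof (rule nn_integral_cong)
      fix y
      have "ennreal (1 / norm (x - y)) * (W y * indicator \<Omega> y)
        = (\<integral>\<^sup>+x'. (ennreal (1 / norm (x - y)) * indicator \<Omega> y) * (w x' * ennreal (1 / norm (x' - y))) \<partial>lborel)"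
        unfolding W_def by (subst nn_integral_cmult) (simp_all add: mult_ac)
      also have "\<dots> = (\<integral>\<^sup>+x'. w x' * (ennreal (1 / (norm (x - y) * norm (x' - y))) * indicator \<Omega> y) \<partial>lborel)"
      proof (rule nn_integral_cong)
        fix x'
        have "ennreal (1 / (norm (x - y) * norm (x' - y))) = ennreal (1 / norm (x - y)) * ennreal (1 / norm (x' - y))"
          by (simp add: ennreal_mult[symmetric])
        then show "(ennreal (1 / norm (x - y)) * indicator \<Omega> y) * (w x' * ennreal (1 / norm (x' - y)))
          = w x' * (ennreal (1 / (norm (x - y) * norm (x' - y))) * indicator \<Omega> y)"
          by (simp only: mult_ac)
      qed
      finally show "ennreal (1 / norm (x - y)) * (W y * indicator \<Omega> y)
        = (\<integral>\<^sup>+x'. w x' * (ennreal (1 / (norm (x - y) * norm (x' - y))) * indicator \<Omega> y) \<partial>lborel)" .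
    qed
    also have "\<dots> = (\<integral>\<^sup>+x'. \<integral>\<^sup>+y. w x' * (ennreal (1 / (norm (x - y) * norm (x' - y))) * indicator \<Omega> y) \<partial>lborel \<partial>lborel)"
      by (rule lborel_pair.Fubini') measurable
    also have "\<dots> = (\<integral>\<^sup>+x'. w x' * log_kernel \<Omega> x x' \<partial>lborel)"
      unfolding log_kernel_def by (intro nn_integral_cong nn_integral_cmult) measurable
    finally show "(\<integral>\<^sup>+y. ennreal (1 / norm (x - y)) * (W y * indicator \<Omega> y) \<partial>lborel)
       = (\<integral>\<^sup>+x'. w x' * log_kernel \<Omega> x x' \<partial>lborel)" .
  qed
  finally show ?thesis .
qed

subsection \<open>Gibbs densities and separated sets\<close>

lemma set_integrable_bounded_continuous:
  fixes h :: "'a::euclidean_space \<Rightarrow> real"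
  assumes "continuous_on UNIV h" "bounded S" "S \<in> sets borel"
  shows "set_integrable lborel S h"
proof -
  have "compact (closure S)" using assms by (simp add: compact_closure)
  then have "set_integrable lborel (closure S) h"
    unfolding set_integrable_def
    by (rule borel_integrable_compact) (use assms(1) continuous_on_subset in blast)
  then show ?thesis
    by (rule set_integrable_subset) (use assms in \<open>auto simp: closure_subset\<close>)
qed

text \<open>The equality case of the Gibbs variational principle. For positive normalisation Z, the
  entropy integral of w ln w equals the integral of f w minus ln Z; this is how ln Z enters the
  estimate.\<close>

definition gibbs :: "(real^2 \<Rightarrow> real) \<Rightarrow> (real^2) set \<Rightarrow> real^2 \<Rightarrow> real" where
  "gibbs f S x = indicator S x * exp (f x) / (LINT y:S|lborel. exp (f y))"

lemma gibbs_nonneg: "gibbs f S x \<ge> 0"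
  unfolding gibbs_def set_lebesgue_integral_def
  by (intro divide_nonneg_nonneg integral_nonneg_AE mult_nonneg_nonneg) auto

text \<open>The additive constant \<open>2 * pi * (3 + 2 / \<eta>)\<close> of
  \<open>log_kernel_le\<close> at \<open>\<eta> = (1 - t) / (2 * t)\<close>.\<close>

definition kernel_const :: "real \<Rightarrow> real" where
  "kernel_const t = 2 * pi * (3 + 4 * t / (1 - t))"

text \<open>The choice \<open>\<eta> = (1 - t) / 2t\<close> turns the coefficient \<open>2t(1 + \<eta>)\<close> of the logarithm into \<open>1 + t < 2\<close>.\<close>

lemma log_kernel_scaled_le:
  fixes x x' :: "real^2"
  assumes "\<Omega> \<subseteq> cball x R" and "x \<noteq> x'" and "norm (x - x') \<le> R" and t: "0 < t" "t < 1"
  shows "ennreal (t / pi) * log_kernel \<Omega> x x' \<le> ennreal ((1 + t) * ln (R / norm (x - x')) + t / pi * kernel_const t)"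
proof -
  define \<eta> where "\<eta> = (1 - t) / (2 * t)"
  have "\<eta> > 0" using t by (simp add: \<eta>_def)
  have "ennreal (t / pi) * log_kernel \<Omega> x x'
      \<le> ennreal (t / pi) * ennreal (2 * pi * (1 + \<eta>) * ln (R / norm (x - x')) + 2 * pi * (3 + 2 / \<eta>))"
    using log_kernel_le[OF assms(1-3) \<open>\<eta> > 0\<close>] by (rule mult_left_mono) simp
  also have "\<dots> = ennreal (t / pi * (2 * pi * (1 + \<eta>) * ln (R / norm (x - x')) + 2 * pi * (3 + 2 / \<eta>)))"
    using t by (subst ennreal_mult'[symmetric]) auto
  also have "t / pi * (2 * pi * (1 + \<eta>) * ln (R / norm (x - x')) + 2 * pi * (3 + 2 / \<eta>))
      = (2 * t * (1 + \<eta>)) * ln (R / norm (x - x')) + t / pi * (2 * pi * (3 + 2 / \<eta>))"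
    by (simp add: field_simps)
  also have "2 * t * (1 + \<eta>) = 1 + t"
    using t by (simp add: \<eta>_def field_simps)
  also have "2 * pi * (3 + 2 / \<eta>) = kernel_const t"
    using t by (simp add: \<eta>_def kernel_const_def)
  finally show ?thesis .
qed

text \<open>Bounds the integral of the exponentiated kernel bound over a disc of radius
  \<open>R\<close>: the factor \<open>R powr (1 + t)\<close> from the logarithm meets
  \<open>2 * pi * R powr (1 - t) / (1 - t)\<close> from the singularity.\<close>

definition gibbs_const :: "real \<Rightarrow> real \<Rightarrow> real" where
  "gibbs_const t R = exp (t / pi * kernel_const t) * (2 * pi * R\<^sup>2 / (1 - t))"

context
  fixes f :: "real^2 \<Rightarrow> real" and S :: "(real^2) set"
  assumes cont: "continuous_on UNIV f" and S: "S \<in> sets borel" "bounded S"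
    and Z: "(LINT y:S|lborel. exp (f y)) > 0"
begin

lemma borel_measurable_gibbs [measurable]: "gibbs f S \<in> borel_measurable borel"
proof -
  have [measurable]: "f \<in> borel_measurable borel" using cont by (rule borel_measurable_continuous_onI)
  show ?thesis using S unfolding gibbs_def by measurable
qed

lemma integrable_gibbs_mult:
  assumes "continuous_on UNIV h"
  shows "integrable lborel (\<lambda>x. h x * gibbs f S x)"
proof -
  have "set_integrable lborel S (\<lambda>x. h x * exp (f x))"
    using assms cont S by (intro set_integrable_bounded_continuous continuous_intros)
  then have "integrable lborel (\<lambda>x. (indicator S x * (h x * exp (f x))) / (LINT y:S|lborel. exp (f y)))"
    unfolding set_integrable_def by simp
  then show ?thesis by (simp add: gibbs_def mult_ac)
qed

lemma integrable_gibbs: "integrable lborel (gibbs f S)"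
  using integrable_gibbs_mult[of "\<lambda>_. 1"] by simp

lemma integral_gibbs: "(\<integral>x. gibbs f S x \<partial>lborel) = 1"
  using Z unfolding gibbs_def by (simp add: set_lebesgue_integral_def)

lemma nn_integral_gibbs: "(\<integral>\<^sup>+x. ennreal (gibbs f S x) \<partial>lborel) = 1"
  using integrable_gibbs integral_gibbs
  by (subst nn_integral_eq_integral) (auto simp: gibbs_nonneg)

text \<open>Instead of Jensen's inequality, the crude \<open>s \<le> e\<^sup>s\<close> suffices, since the additive constant is immaterial.\<close>

lemma gibbs_kernel_le:
  fixes \<Omega> :: "(real^2) set"
  assumes [measurable]: "\<Omega> \<in> sets borel"
    and \<Omega>: "S \<subseteq> \<Omega>" "\<Omega> \<subseteq> cball x R" "R > 0" and t: "0 < t" "t < 1"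
  defines "b \<equiv> gibbs_const t R + (\<integral>y. f y * gibbs f S y \<partial>lborel) - ln (LINT y:S|lborel. exp (f y))"
  shows "ennreal (t / pi) * (\<integral>\<^sup>+x'. ennreal (gibbs f S x') * log_kernel \<Omega> x x' \<partial>lborel) \<le> ennreal b"
    and "0 \<le> b"
proof -
  let ?Z = "LINT y:S|lborel. exp (f y)" and ?w = "gibbs f S"
  \<comment> \<open>\<open>e\<close> makes \<open>H\<close> the exponential, on \<open>S\<close>, of
    the upper bound for \<open>t / pi\<close> times the kernel. \<open>G\<close> adds the entropy
    density, and its integral is at most \<open>b\<close>.\<close>
  define e where "e = exp (t / pi * kernel_const t) * R powr (1 + t)"
  define H where "H y = indicator S y * (e * norm (x - y) powr - (1 + t))" for y
  define G where "G y = H y + ?w y * (f y - ln ?Z)" for y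
  have "e > 0" using \<Omega> by (simp add: e_def)
  have [measurable]: "S \<in> sets borel" by (rule S)
  have [measurable]: "H \<in> borel_measurable borel" unfolding H_def by measurable
  have H0: "H y \<ge> 0" for y using \<open>e > 0\<close> by (simp add: H_def)
  have Hnn: "(\<integral>\<^sup>+y. ennreal (H y) \<partial>lborel) \<le> ennreal (gibbs_const t R)"
  proof -
    have "(\<integral>\<^sup>+y. ennreal (H y) \<partial>lborel)
       \<le> (\<integral>\<^sup>+y. ennreal e * (ennreal (norm (x - y) powr - (1 + t)) * indicator (cball x R) y) \<partial>lborel)"
      using \<Omega> \<open>e > 0\<close> unfolding H_def
      by (intro nn_integral_mono) (auto simp: ennreal_mult' indicator_def)
    also have "\<dots> = ennreal e * (\<integral>\<^sup>+y. ennreal (norm (x - y) powr - (1 + t)) * indicator (cball x R) y \<partial>lborel)"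
      by (intro nn_integral_cmult borel_measurable_times_ennreal borel_measurable_indicator) auto
    also have "\<dots> = ennreal e * ennreal (2 * pi * R powr (2 - (1 + t)) / (2 - (1 + t)))"
      using \<Omega> t by (subst nn_integral_norm_powr) auto
    also have "\<dots> = ennreal (gibbs_const t R)"
    proof -
      have "R powr (1 + t) * R powr (2 - (1 + t)) = R\<^sup>2"
        using \<Omega> by (subst powr_add[symmetric]) (simp add: powr_numeral)
      then have "e * (2 * pi * R powr (2 - (1 + t)) / (2 - (1 + t))) = gibbs_const t R"
        by (simp add: e_def gibbs_const_def mult_ac)
      then show ?thesis using \<open>e > 0\<close> t by (simp add: ennreal_mult'[symmetric])
    qed
    finally show ?thesis .
  qed
  have Hint: "integrable lborel H"
  proof (rule integrableI_nonneg)
    show "(\<integral>\<^sup>+y. ennreal (H y) \<partial>lborel) < \<infinity>" using Hnn by (rule le_less_trans) simp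
  qed (use H0 in auto)
  have "(\<integral>y. H y \<partial>lborel) \<le> gibbs_const t R"
  proof -
    have "ennreal (\<integral>y. H y \<partial>lborel) \<le> ennreal (gibbs_const t R)"
      using Hnn Hint H0 by (subst (asm) nn_integral_eq_integral) auto
    then show ?thesis
      using t by (subst (asm) ennreal_le_iff) (auto simp: gibbs_const_def)
  qed
  moreover have w_int: "integrable lborel (\<lambda>y. f y * ?w y)" "integrable lborel (\<lambda>y. ln ?Z * ?w y)"
    by (rule integrable_gibbs_mult[OF cont], rule integrable_gibbs_mult[OF continuous_on_const])
  have Geq: "G = (\<lambda>y. H y + (f y * ?w y - ln ?Z * ?w y))"
    by (simp add: G_def fun_eq_iff algebra_simps)
  have Gint: "integrable lborel G"
    unfolding Geq by (intro Bochner_Integration.integrable_add Bochner_Integration.integrable_diff Hint w_int)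
  have "(\<integral>y. G y \<partial>lborel) = (\<integral>y. H y \<partial>lborel) + ((\<integral>y. f y * ?w y \<partial>lborel) - (\<integral>y. ln ?Z * ?w y \<partial>lborel))"
    unfolding Geq
    by (simp only: Bochner_Integration.integral_add[OF Hint Bochner_Integration.integrable_diff[OF w_int]]
        Bochner_Integration.integral_diff[OF w_int])
  ultimately have "(\<integral>y. G y \<partial>lborel) \<le> b"
    by (simp add: b_def integral_gibbs)
  \<comment> \<open>The kernel bound requires distinct points; the excluded value
    \<open>y = x\<close> is a null set.\<close>
  have pt: "0 \<le> G y \<and> ennreal (t / pi) * (ennreal (?w y) * log_kernel \<Omega> x y) \<le> ennreal (G y)" if "y \<noteq> x" for y
  proof (cases "y \<in> S")
    case True
    have n: "0 < norm (x - y)" "norm (x - y) \<le> R"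
      using that True \<Omega> by (auto simp: dist_norm subset_iff)
    define s where "s = (1 + t) * ln (R / norm (x - y)) + t / pi * kernel_const t"
    have "s \<ge> 0" using n t by (auto simp: s_def kernel_const_def)
    have "s = t / pi * kernel_const t + (1 + t) * ln R + - (1 + t) * ln (norm (x - y))"
      using n \<Omega>(3) by (simp add: s_def ln_div algebra_simps)
    then have e_s: "exp s = e * norm (x - y) powr - (1 + t)"
      using n \<Omega>(3) by (simp only: exp_add e_def powr_def) simp
    \<comment> \<open>The exponent is \<open>s\<close> minus the logarithm of the density.
      Multiplied by the density, the right side becomes exp s, that is, \<open>H y\<close>.\<close>
    have "s - f y + ln ?Z \<le> exp (s - f y + ln ?Z)"
      using exp_ge_add_one_self[of "s - f y + ln ?Z"] by linarith
    also have "\<dots> = exp s * ?Z / exp (f y)"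
      using Z by (simp add: exp_add exp_diff)
    finally have "?w y * (s - f y + ln ?Z) \<le> ?w y * (exp s * ?Z / exp (f y))"
      by (rule mult_left_mono) (rule gibbs_nonneg)
    also have "\<dots> = H y"
      using True Z by (simp add: gibbs_def H_def e_s)
    finally have wsG: "?w y * s \<le> G y"
      by (simp add: G_def algebra_simps)
    have "ennreal (t / pi) * (ennreal (?w y) * log_kernel \<Omega> x y) = ennreal (?w y) * (ennreal (t / pi) * log_kernel \<Omega> x y)"
      by (simp add: mult_ac)
    also have "\<dots> \<le> ennreal (?w y) * ennreal s"
      using log_kernel_scaled_le[OF \<Omega>(2) _ n(2) t] that unfolding s_def by (intro mult_left_mono) auto
    also have "\<dots> \<le> ennreal (G y)"
      using wsG by (simp add: ennreal_mult'[symmetric] gibbs_nonneg ennreal_leI)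
    finally show ?thesis
      using wsG \<open>s \<ge> 0\<close> gibbs_nonneg[of f S y] by (auto intro: order_trans[OF mult_nonneg_nonneg])
  qed (simp add: gibbs_def G_def H_def)
  have pt_AE: "AE y in lborel. 0 \<le> G y" "AE y in lborel. ennreal (t / pi) * (ennreal (?w y) * log_kernel \<Omega> x y) \<le> ennreal (G y)"
    using pt by (auto intro!: AE_mp[OF AE_lborel_singleton[of x] AE_I2])
  \<comment> \<open>\<open>ennreal\<close> truncates negative reals to 0, so this sign is needed
    when the bounds for several sets are added as reals.\<close>
  show "0 \<le> b"
    using integral_nonneg_AE[OF pt_AE(1)] \<open>(\<integral>y. G y \<partial>lborel) \<le> b\<close> by linarith
  show "ennreal (t / pi) * (\<integral>\<^sup>+x'. ennreal (?w x') * log_kernel \<Omega> x x' \<partial>lborel) \<le> ennreal b"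
  proof -
    have "ennreal (t / pi) * (\<integral>\<^sup>+x'. ennreal (?w x') * log_kernel \<Omega> x x' \<partial>lborel)
        = (\<integral>\<^sup>+x'. ennreal (t / pi) * (ennreal (?w x') * log_kernel \<Omega> x x') \<partial>lborel)"
      by (rule nn_integral_cmult[symmetric]) measurable
    also have "\<dots> \<le> (\<integral>\<^sup>+x'. ennreal (G x') \<partial>lborel)"
      by (rule nn_integral_mono_AE) (rule pt_AE)
    also have "\<dots> = ennreal (\<integral>x'. G x' \<partial>lborel)"
      by (rule nn_integral_eq_integral[OF Gint pt_AE(1)])
    also have "\<dots> \<le> ennreal b"
      using \<open>(\<integral>y. G y \<partial>lborel) \<le> b\<close> by (rule ennreal_leI)
    finally show ?thesis .
  qed
qed

end

section \<open>The Moser-Trudinger inequality for separated sets\<close>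

definition cross_const :: "real \<Rightarrow> real \<Rightarrow> real \<Rightarrow> real" where
  "cross_const t R d = (1 + t) * \<bar>ln (R / d)\<bar> + t / pi * kernel_const t"

text \<open>Testing with the sum of the Gibbs densities bounds the sum of the \<open>E i\<close> by
  the energy plus the sum of the \<open>b i\<close>, up to constants. Each \<open>b i\<close>
  contains \<open>E i\<close> with coefficient 1 and minus the logarithm of the i-th integral, so
  the \<open>E i\<close> cancel. The energy coefficient does not grow with the number of sets, which
  is the gain from separation.\<close>

theorem moser_trudinger_separated:
  fixes f :: "real^2 \<Rightarrow> real" and g :: "real^2 \<Rightarrow> real^2" and S :: "'i \<Rightarrow> (real^2) set"
  assumes deriv: "\<And>x. (f has_derivative (\<lambda>h. g x \<bullet> h)) (at x)"
    and cont: "continuous_on UNIV g"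
    and supp: "bounded {x. f x \<noteq> 0}"
    and g0: "\<And>x. x \<notin> \<Omega> \<Longrightarrow> g x = 0"
    and g2: "integrable lborel (\<lambda>x. (norm (g x))\<^sup>2)"
    and \<Omega>: "\<Omega> \<in> sets borel" "\<And>x. x \<in> \<Omega> \<Longrightarrow> \<Omega> \<subseteq> cball x R" "R > 0"
    and I: "finite I"
    and S: "\<And>i. i \<in> I \<Longrightarrow> S i \<in> sets borel" "\<And>i. i \<in> I \<Longrightarrow> S i \<subseteq> \<Omega>"
    and sep: "\<And>i j x y. i \<in> I \<Longrightarrow> j \<in> I \<Longrightarrow> i \<noteq> j \<Longrightarrow> x \<in> S i \<Longrightarrow> y \<in> S j \<Longrightarrow> d \<le> dist x y"
    and "d > 0"
    and Z: "\<And>i. i \<in> I \<Longrightarrow> (LINT x:S i|lborel. exp (f x)) > 0"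
    and t: "0 < t" "t < 1"
  shows "(\<Sum>i\<in>I. ln (LINT x:S i|lborel. exp (f x)))
    \<le> 1 / (16 * pi * t) * (\<integral>x. (norm (g x))\<^sup>2 \<partial>lborel)
      + card I * (gibbs_const t R + card I * cross_const t R d)"
proof -
  have contf: "continuous_on UNIV f"
    using deriv by (meson continuous_at_imp_continuous_on has_derivative_continuous)
  have bdd: "bounded (S i)" if "i \<in> I" for i
  proof (cases "S i = {}")
    case False
    then obtain x where "x \<in> S i" by auto
    then have "S i \<subseteq> cball x R" using S(2)[OF that] \<Omega>(2)[of x] by auto
    then show ?thesis by (rule bounded_subset[OF bounded_cball])
  qed simp
  note G = contf S(1) bdd Z
  define w where "w i = gibbs f (S i)" for i
  have w0: "w i x \<ge> 0" for i x by (simp add: w_def gibbs_nonneg)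
  have wm: "w i \<in> borel_measurable borel" if "i \<in> I" for i
    unfolding w_def using that by (intro borel_measurable_gibbs G)
  define E where "E i = (\<integral>x. f x * w i x \<partial>lborel)" for i
  define b where "b i = gibbs_const t R + E i - ln (LINT x:S i|lborel. exp (f x))" for i
  define c where "c = cross_const t R d"
  define W where "W x = (\<Sum>i\<in>I. ennreal (w i x))" for x
  have cc: "c \<ge> 0" using t by (simp add: c_def cross_const_def kernel_const_def)
  have Wm [measurable]: "W \<in> borel_measurable borel"
    unfolding W_def using wm by (intro borel_measurable_sum) measurable
  have [measurable]: "\<Omega> \<in> sets borel" by (rule \<Omega>)
  have wint: "integrable lborel (\<lambda>x. h x * w i x)" if "i \<in> I" "continuous_on UNIV h" for i h
    unfolding w_def using that by (intro integrable_gibbs_mult G)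
  have w1: "(\<integral>\<^sup>+x. ennreal (w i x) \<partial>lborel) = 1" if "i \<in> I" for i
    unfolding w_def using that by (intro nn_integral_gibbs G)
  \<comment> \<open>The factor \<open>w i x\<close> confines \<open>x\<close> to \<open>S i\<close>,
    where only the term \<open>j = i\<close> meets the singularity of the kernel.\<close>
  have inner: "ennreal (w i x) * (ennreal (t / pi) * (\<integral>\<^sup>+x'. W x' * log_kernel \<Omega> x x' \<partial>lborel)) \<le> ennreal (w i x) * ennreal (b i + card I * c)"
    and b0: "0 \<le> b i" if i: "i \<in> I" for i x
  proof -
    obtain x0 where x0: "x0 \<in> S i"
      using Z[OF i] by (cases "S i = {}") (auto simp: set_lebesgue_integral_def)
    show b0: "0 \<le> b i"
      using gibbs_kernel_le(2)[OF G(1) G(2)[OF i] G(3)[OF i] G(4)[OF i] \<Omega>(1) S(2)[OF i] \<Omega>(2) \<Omega>(3) t, of x0] x0 S(2)[OF i]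
      by (auto simp: b_def E_def w_def)
    show "ennreal (w i x) * (ennreal (t / pi) * (\<integral>\<^sup>+x'. W x' * log_kernel \<Omega> x x' \<partial>lborel)) \<le> ennreal (w i x) * ennreal (b i + card I * c)"
    proof (cases "x \<in> S i")
      case True
      then have x: "\<Omega> \<subseteq> cball x R" using S(2)[OF i] \<Omega>(2) by auto
      have summand: "ennreal (t / pi) * (\<integral>\<^sup>+x'. ennreal (w j x') * log_kernel \<Omega> x x' \<partial>lborel)
          \<le> ennreal ((if j = i then b i else 0) + c)" if j: "j \<in> I" for j
      proof (cases "j = i")
        case True
        have "ennreal (t / pi) * (\<integral>\<^sup>+x'. ennreal (w j x') * log_kernel \<Omega> x x' \<partial>lborel) \<le> ennreal (b i)"
          using gibbs_kernel_le(1)[OF G(1) G(2)[OF i] G(3)[OF i] G(4)[OF i] \<Omega>(1) S(2)[OF i] x \<Omega>(3) t] True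
          by (simp add: b_def E_def w_def)
        \<comment> \<open>Adding \<open>c\<close> on the diagonal as well gives every summand the
          same constant, hence the total \<open>card I * c\<close>.\<close>
        also have "\<dots> \<le> ennreal (b i + c)" using cc by (intro ennreal_leI) simp
        finally show ?thesis using True by simp
      next
        case False
        have "ennreal (t / pi) * (\<integral>\<^sup>+x'. ennreal (w j x') * log_kernel \<Omega> x x' \<partial>lborel)
           = (\<integral>\<^sup>+x'. ennreal (w j x') * (ennreal (t / pi) * log_kernel \<Omega> x x') \<partial>lborel)"
          using wm[OF j] by (subst nn_integral_cmult[symmetric]) (auto simp: mult.left_commute)
        also have "\<dots> \<le> (\<integral>\<^sup>+x'. ennreal c * ennreal (w j x') \<partial>lborel)"
        proof (rule nn_integral_mono)
          fix x'
          show "ennreal (w j x') * (ennreal (t / pi) * log_kernel \<Omega> x x') \<le> ennreal c * ennreal (w j x')"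
          proof (cases "x' \<in> S j")
            case True
            have d: "d \<le> norm (x - x')" using sep[OF i j _ \<open>x \<in> S i\<close> True] False by (simp add: dist_norm)
            have R: "norm (x - x') \<le> R" using True S(2)[OF j] x by (auto simp: dist_norm)
            \<comment> \<open>The absolute value in \<open>cross_const\<close> keeps the constant
              nonnegative even if \<open>d\<close> exceeds \<open>R\<close>.\<close>
            have "ln (R / norm (x - x')) \<le> \<bar>ln (R / d)\<bar>"
            proof -
              have "ln (R / norm (x - x')) \<le> ln (R / d)"
                using d \<open>d > 0\<close> \<Omega>(3) less_le_trans[OF \<open>d > 0\<close> d]
                by (intro ln_mono divide_left_mono mult_pos_pos divide_pos_pos) simp_all
              then show ?thesis by simp
            qed
            then have "(1 + t) * ln (R / norm (x - x')) + t / pi * kernel_const t \<le> c"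
              using t unfolding c_def cross_const_def by (intro add_right_mono mult_left_mono) auto
            then have "ennreal (t / pi) * log_kernel \<Omega> x x' \<le> ennreal c"
              using d \<open>d > 0\<close> by (intro order_trans[OF log_kernel_scaled_le[OF x _ R t]] ennreal_leI) auto
            then show ?thesis by (subst mult.commute[of "ennreal c"]) (rule mult_left_mono, auto)
          qed (simp add: w_def gibbs_def)
        qed
        also have "\<dots> = ennreal c"
          using w1[OF j] wm[OF j] by (simp add: nn_integral_cmult)
        finally show ?thesis using False by simp
      qed
      have "ennreal (t / pi) * (\<integral>\<^sup>+x'. W x' * log_kernel \<Omega> x x' \<partial>lborel)
        = (\<Sum>j\<in>I. ennreal (t / pi) * (\<integral>\<^sup>+x'. ennreal (w j x') * log_kernel \<Omega> x x' \<partial>lborel))"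
        unfolding W_def sum_distrib_right using wm
        by (subst nn_integral_sum) (auto simp: sum_distrib_left)
      also have "\<dots> \<le> (\<Sum>j\<in>I. ennreal ((if j = i then b i else 0) + c))"
        by (intro sum_mono summand)
      also have "\<dots> = ennreal (\<Sum>j\<in>I. ((if j = i then b i else 0) + c))"
        using b0 cc by (intro sum_ennreal) auto
      also have "(\<Sum>j\<in>I. ((if j = i then b i else 0) + c)) = b i + card I * c"
        using i I by (simp add: sum.distrib)
      finally show ?thesis by (intro mult_left_mono) auto
    qed (simp add: w_def gibbs_def)
  qed
  define A where "A = (\<integral>x. (norm (g x))\<^sup>2 \<partial>lborel)"
  have A0: "A \<ge> 0" by (simp add: A_def)
  have "ennreal (t / pi) * (\<integral>\<^sup>+x. W x * (\<integral>\<^sup>+x'. W x' * log_kernel \<Omega> x x' \<partial>lborel) \<partial>lborel)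
    = (\<integral>\<^sup>+x. (\<Sum>i\<in>I. ennreal (w i x) * (ennreal (t / pi) * (\<integral>\<^sup>+x'. W x' * log_kernel \<Omega> x x' \<partial>lborel))) \<partial>lborel)"
    unfolding sum_distrib_right[symmetric] W_def[symmetric]
    by (subst nn_integral_cmult[symmetric]) (auto simp: mult.left_commute)
  also have "\<dots> \<le> (\<integral>\<^sup>+x. (\<Sum>i\<in>I. ennreal (w i x) * ennreal (b i + card I * c)) \<partial>lborel)"
    by (intro nn_integral_mono sum_mono inner)
  also have "\<dots> = (\<Sum>i\<in>I. ennreal (b i + card I * c))"
    using wm w1 by (subst nn_integral_sum) (auto simp: nn_integral_multc)
  also have "\<dots> = ennreal (\<Sum>i\<in>I. b i + card I * c)"
    using b0 cc by (intro sum_ennreal) auto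
  finally have interaction: "ennreal (t / pi) * (\<integral>\<^sup>+x. W x * (\<integral>\<^sup>+x'. W x' * log_kernel \<Omega> x x' \<partial>lborel) \<partial>lborel)
      \<le> ennreal (\<Sum>i\<in>I. b i + card I * c)" .
  have "ennreal (\<Sum>i\<in>I. E i) \<le> ennreal (\<Sum>i\<in>I. \<integral>x. \<bar>f x\<bar> * w i x \<partial>lborel)"
  proof (intro ennreal_leI sum_mono)
    fix i assume i: "i \<in> I"
    show "E i \<le> (\<integral>x. \<bar>f x\<bar> * w i x \<partial>lborel)"
      unfolding E_def using i contf
      by (intro integral_mono wint mult_right_mono w0 continuous_intros) auto
  qed
  also have "\<dots> = (\<Sum>i\<in>I. ennreal (\<integral>x. \<bar>f x\<bar> * w i x \<partial>lborel))"
    by (rule sum_ennreal[symmetric]) (simp add: w0)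
  also have "\<dots> = (\<Sum>i\<in>I. \<integral>\<^sup>+x. ennreal (\<bar>f x\<bar> * w i x) \<partial>lborel)"
    using contf w0
    by (intro sum.cong nn_integral_eq_integral[symmetric] wint continuous_intros) auto
  also have "\<dots> = (\<integral>\<^sup>+x. ennreal \<bar>f x\<bar> * W x \<partial>lborel)"
  proof -
    have [measurable]: "f \<in> borel_measurable borel" using contf by (rule borel_measurable_continuous_onI)
    show ?thesis
      unfolding W_def sum_distrib_left using wm
      by (subst nn_integral_sum) (auto intro!: sum.cong nn_integral_cong simp: ennreal_mult w0)
  qed
  also have "\<dots> \<le> ennreal (1 / (16 * pi * t)) * (\<integral>\<^sup>+y. ennreal ((norm (g y))\<^sup>2) \<partial>lborel)
      + ennreal (t / pi) * (\<integral>\<^sup>+x. W x * (\<integral>\<^sup>+x'. W x' * log_kernel \<Omega> x x' \<partial>lborel) \<partial>lborel)"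
    by (rule pairing_le[OF deriv cont supp g0]) (use t in measurable)
  also have "(\<integral>\<^sup>+y. ennreal ((norm (g y))\<^sup>2) \<partial>lborel) = ennreal A"
    unfolding A_def by (rule nn_integral_eq_integral[OF g2]) simp
  also note add_left_mono[OF interaction]
  also have "ennreal (1 / (16 * pi * t)) * ennreal A + ennreal (\<Sum>i\<in>I. b i + card I * c)
      = ennreal (1 / (16 * pi * t) * A + (\<Sum>i\<in>I. b i + card I * c))"
    using A0 t b0 cc by (subst ennreal_plus) (auto intro!: sum_nonneg simp: ennreal_mult'[symmetric])
  finally have "ennreal (\<Sum>i\<in>I. E i) \<le> ennreal (1 / (16 * pi * t) * A + (\<Sum>i\<in>I. b i + card I * c))" .
  then have "(\<Sum>i\<in>I. E i) \<le> 1 / (16 * pi * t) * A + (\<Sum>i\<in>I. b i + card I * c)"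
    using A0 t b0 cc by (subst (asm) ennreal_le_iff) (auto intro!: add_nonneg_nonneg sum_nonneg)
  \<comment> \<open>Unfolding \<open>b\<close> brings the sum of the \<open>E i\<close> to the right
    side too, where it cancels against the left.\<close>
  also have "\<dots> = 1 / (16 * pi * t) * A + card I * (gibbs_const t R + card I * c) + (\<Sum>i\<in>I. E i)
      - (\<Sum>i\<in>I. ln (LINT x:S i|lborel. exp (f x)))"
    by (simp add: b_def sum.distrib sum_subtractf algebra_simps)
  finally show ?thesis
    unfolding A_def c_def by simp
qed

subsection \<open>Passage to Sobolev functions\<close>

lemma test_function_derivative:
  assumes "\<phi> \<in> test_functions \<Omega>"
  shows "(\<phi> has_derivative (\<lambda>h. grad \<phi> x \<bullet> h)) (at x)"
proof -
  have "Ck_on (Suc 0) UNIV \<phi>" using assms by (auto simp: test_functions_def smooth_on_def)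
  then have "\<phi> differentiable (at x)" by simp
  then have D: "(\<phi> has_derivative frechet_derivative \<phi> (at x)) (at x)"
    by (simp add: frechet_derivative_works)
  then interpret linear "frechet_derivative \<phi> (at x)" by (rule has_derivative_linear)
  have "frechet_derivative \<phi> (at x) h = grad \<phi> x \<bullet> h" for h
  proof -
    have "h = (\<Sum>i\<in>UNIV. (h $ i) *\<^sub>R axis i 1)"
      by (simp add: basis_expansion scalar_mult_eq_scaleR[symmetric])
    then have "frechet_derivative \<phi> (at x) h = frechet_derivative \<phi> (at x) (\<Sum>i\<in>UNIV. (h $ i) *\<^sub>R axis i 1)"
      by (rule arg_cong)
    also have "\<dots> = (\<Sum>i\<in>UNIV. (h $ i) * frechet_derivative \<phi> (at x) (axis i 1))"
      by (simp add: sum scale)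
    finally show ?thesis by (simp add: grad_def inner_vec_def mult.commute)
  qed
  then have "frechet_derivative \<phi> (at x) = (\<lambda>h. grad \<phi> x \<bullet> h)" by (rule ext)
  with D show ?thesis by simp
qed

lemma continuous_on_test_function:
  "\<phi> \<in> test_functions \<Omega> \<Longrightarrow> continuous_on UNIV \<phi>"
  using test_function_derivative by (meson continuous_at_imp_continuous_on has_derivative_continuous)

lemma continuous_on_grad:
  assumes "\<phi> \<in> test_functions \<Omega>"
  shows "continuous_on UNIV (grad \<phi>)"
proof -
  have "Ck_on (Suc 0) UNIV \<phi>" using assms by (auto simp: test_functions_def smooth_on_def)
  then have "continuous_on UNIV (\<lambda>x. frechet_derivative \<phi> (at x) (axis i 1))" for i
    by (simp add: axis_in_Basis_iff)
  then show ?thesis unfolding grad_def[abs_def] by (intro continuous_on_vec_lambda) auto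
qed

lemma grad_eq_0:
  assumes "\<phi> \<in> test_functions \<Omega>" "x \<notin> \<Omega>"
  shows "grad \<phi> x = 0"
proof -
  let ?K = "closure {x. \<phi> x \<noteq> 0}"
  have "x \<in> - ?K" using assms by (auto simp: test_functions_def)
  moreover have "0 = \<phi> y" if "y \<in> - ?K" for y
    using that closure_subset[of "{x. \<phi> x \<noteq> 0}"] by auto
  moreover have "open (- ?K)" by (rule open_Compl[OF closed_closure])
  ultimately have "(\<phi> has_derivative (\<lambda>_. 0)) (at x)"
    using has_derivative_transform_within_open[OF has_derivative_const[of 0 "at x"]] by blast
  then have "frechet_derivative \<phi> (at x) = (\<lambda>_. 0)" by (rule frechet_derivative_at[symmetric])
  then show ?thesis by (simp add: grad_def vec_eq_iff)
qed

text \<open>Passes between \<open>lebesgue_on\<close>, used in the definitions, and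
  \<open>lborel\<close>, used in the estimates; for Borel data the completion changes
  nothing.\<close>

lemma integrable_lebesgue_on_iff:
  fixes h :: "'a::euclidean_space \<Rightarrow> real"
  assumes "S \<in> sets borel" "h \<in> borel_measurable borel"
  shows "integrable (lebesgue_on S) h \<longleftrightarrow> set_integrable lborel S h"
    and "(\<integral>x. h x \<partial>lebesgue_on S) = (LINT x:S|lborel. h x)"
proof -
  have m: "(\<lambda>x. indicator S x *\<^sub>R h x) \<in> borel_measurable lborel" using assms by simp
  show "integrable (lebesgue_on S) h \<longleftrightarrow> set_integrable lborel S h"
    using assms integrable_completion[OF m] unfolding set_integrable_def
    by (subst integrable_restrict_space) auto
  show "(\<integral>x. h x \<partial>lebesgue_on S) = (LINT x:S|lborel. h x)"
    using assms integral_completion[OF m] unfolding set_lebesgue_integral_def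
    by (subst integral_restrict_space) auto
qed

lemma square_integrable_continuous:
  fixes h :: "real^2 \<Rightarrow> 'b::{second_countable_topology, real_normed_vector}"
  assumes "continuous_on UNIV h" "bounded \<Omega>" "open \<Omega>"
  shows "square_integrable \<Omega> h"
  unfolding square_integrable_def
proof
  have c: "continuous_on UNIV (\<lambda>x. (norm (h x))\<^sup>2)"
    by (intro continuous_intros assms)
  then have "set_integrable lborel \<Omega> (\<lambda>x. (norm (h x))\<^sup>2)"
    using assms by (intro set_integrable_bounded_continuous) auto
  then show "integrable (lebesgue_on \<Omega>) (\<lambda>x. (norm (h x))\<^sup>2)"
    using assms c by (subst integrable_lebesgue_on_iff) (auto intro: borel_measurable_continuous_onI)
  have "h \<in> borel_measurable lebesgue"
    using assms by (intro measurable_completion) (simp add: borel_measurable_continuous_onI)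
  then show "h \<in> borel_measurable (lebesgue_on \<Omega>)" by (rule measurable_restrict_space1)
qed

lemma norm_diff_square_le: "(norm (a - b))\<^sup>2 \<le> 2 * ((norm a)\<^sup>2 + (norm b)\<^sup>2)"
  for a :: "'b::real_normed_vector"
proof -
  have "(norm (a - b))\<^sup>2 \<le> (norm a + norm b)\<^sup>2"
    by (intro power_mono norm_triangle_ineq4) simp
  also have "\<dots> \<le> 2 * ((norm a)\<^sup>2 + (norm b)\<^sup>2)"
    using zero_le_power2[of "norm a - norm b"] by (simp add: power2_eq_square algebra_simps)
  finally show ?thesis .
qed

lemma square_integrable_diff:
  fixes a b :: "real^2 \<Rightarrow> 'b::{second_countable_topology, real_normed_vector}"
  assumes "square_integrable \<Omega> a" "square_integrable \<Omega> b"
  shows "integrable (lebesgue_on \<Omega>) (\<lambda>x. (norm (a x - b x))\<^sup>2)"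
proof (rule Bochner_Integration.integrable_bound)
  have [measurable]: "a \<in> borel_measurable (lebesgue_on \<Omega>)" "b \<in> borel_measurable (lebesgue_on \<Omega>)"
    using assms by (auto simp: square_integrable_def)
  show "(\<lambda>x. (norm (a x - b x))\<^sup>2) \<in> borel_measurable (lebesgue_on \<Omega>)" by measurable
  show "integrable (lebesgue_on \<Omega>) (\<lambda>x. 2 * ((norm (a x))\<^sup>2 + (norm (b x))\<^sup>2))"
    using assms by (auto simp: square_integrable_def)
qed (use norm_diff_square_le in \<open>auto simp del: distrib_left_numeral\<close>)

text \<open>Convexity of the square with weights \<open>t\<close> and \<open>1 - t\<close>. Applied
  to gradients, the limit energy loses only the factor \<open>1 / t\<close>, while the large factor
  falls on an error tending to 0.\<close>

lemma norm_square_split: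
  fixes a b :: "'b::real_normed_vector"
  assumes "0 < t" "t < 1"
  shows "(norm b)\<^sup>2 \<le> (norm a)\<^sup>2 / t + (norm (a - b))\<^sup>2 / (1 - t)"
proof -
  let ?p = "norm a" and ?q = "norm (a - b)"
  have "norm b \<le> ?p + ?q" by (metis norm_minus_commute norm_triangle_sub)
  then have "(norm b)\<^sup>2 \<le> (?p + ?q)\<^sup>2" by (intro power_mono) auto
  also have "\<dots> \<le> ?p\<^sup>2 / t + ?q\<^sup>2 / (1 - t)"
  proof -
    have "0 \<le> ((1 - t) * ?p - t * ?q)\<^sup>2 / (t * (1 - t))" using assms by simp
    also have "\<dots> = ?p\<^sup>2 / t + ?q\<^sup>2 / (1 - t) - (?p + ?q)\<^sup>2"
      using assms by (simp add: divide_simps) (simp add: power2_eq_square algebra_simps)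
    finally show ?thesis by simp
  qed
  finally show ?thesis .
qed

text \<open>Convergence in L2 gives a subsequence converging almost everywhere, as Fatou's lemma
  requires; the gradients still converge in L2 along it.\<close>

lemma H10_approximation:
  assumes \<Omega>: "open \<Omega>" "bounded \<Omega>" and u: "u \<in> H10 \<Omega>"
  obtains \<phi> where "\<And>n. \<phi> n \<in> test_functions \<Omega>"
    and "AE x in lebesgue. x \<in> \<Omega> \<longrightarrow> (\<lambda>n. \<phi> n x) \<longlonglongrightarrow> u x"
    and "(\<lambda>n. \<integral>x. (norm (weak_gradient \<Omega> u x - grad (\<phi> n) x))\<^sup>2 \<partial>lebesgue_on \<Omega>) \<longlonglongrightarrow> 0"
    and "square_integrable \<Omega> u" and "square_integrable \<Omega> (weak_gradient \<Omega> u)"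
proof -
  let ?G = "weak_gradient \<Omega> u"
  have "\<exists>G. has_weak_gradient \<Omega> u G" using u by (auto simp: H10_def H1_def)
  then have "has_weak_gradient \<Omega> u ?G" unfolding weak_gradient_def by (rule someI_ex)
  then have sq: "square_integrable \<Omega> u" "square_integrable \<Omega> ?G"
    by (auto simp: has_weak_gradient_def)
  obtain \<phi> where \<phi>: "\<And>n. \<phi> n \<in> test_functions \<Omega>" and
    lim: "(\<lambda>n. (\<integral>x. (u x - \<phi> n x)\<^sup>2 \<partial>lebesgue_on \<Omega>) +
           (\<integral>x. (norm (?G x - grad (\<phi> n) x))\<^sup>2 \<partial>lebesgue_on \<Omega>)) \<longlonglongrightarrow> 0"
    using u by (auto simp: H10_def)
  have lim1: "(\<lambda>n. \<integral>x. (u x - \<phi> n x)\<^sup>2 \<partial>lebesgue_on \<Omega>) \<longlonglongrightarrow> 0"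
    by (rule tendsto_sandwich[OF _ _ tendsto_const lim]) (auto intro!: always_eventually)
  have lim2: "(\<lambda>n. \<integral>x. (norm (?G x - grad (\<phi> n) x))\<^sup>2 \<partial>lebesgue_on \<Omega>) \<longlonglongrightarrow> 0"
    by (rule tendsto_sandwich[OF _ _ tendsto_const lim]) (auto intro!: always_eventually)
  have int: "integrable (lebesgue_on \<Omega>) (\<lambda>x. (u x - \<phi> n x)\<^sup>2)" for n
    using square_integrable_diff[OF sq(1) square_integrable_continuous[OF continuous_on_test_function[OF \<phi>] \<Omega>(2,1)], of n]
    by simp
  obtain r :: "nat \<Rightarrow> nat" where r: "strict_mono r"
    and ae: "AE x in lebesgue_on \<Omega>. (\<lambda>n. u x - \<phi> (r n) x) \<longlonglongrightarrow> 0"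
    using tendsto_L1_AE_subseq[of "lebesgue_on \<Omega>" "\<lambda>n x. (u x - \<phi> n x)\<^sup>2"] int lim1 by auto
  have "AE x in lebesgue_on \<Omega>. (\<lambda>n. \<phi> (r n) x) \<longlonglongrightarrow> u x"
    using ae
  proof eventually_elim
    fix x assume "(\<lambda>n. u x - \<phi> (r n) x) \<longlonglongrightarrow> 0"
    from tendsto_diff[OF tendsto_const[of "u x"] this] show "(\<lambda>n. \<phi> (r n) x) \<longlonglongrightarrow> u x" by simp
  qed
  then have "AE x in lebesgue. x \<in> \<Omega> \<longrightarrow> (\<lambda>n. \<phi> (r n) x) \<longlonglongrightarrow> u x"
    using \<Omega> by (subst (asm) AE_restrict_space_iff) auto
  with \<phi> show thesis
    using LIMSEQ_subseq_LIMSEQ[OF lim2 r] sq by (intro that[of "\<phi> \<circ> r"]) (auto simp: o_def)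
qed

lemma grad_energy_le:
  assumes \<Omega>: "open \<Omega>" "bounded \<Omega>" and \<phi>: "\<phi> \<in> test_functions \<Omega>"
    and G: "square_integrable \<Omega> G" and t: "0 < t" "t < 1"
  shows "integrable lborel (\<lambda>x. (norm (grad \<phi> x))\<^sup>2)"
    and "(\<integral>x. (norm (grad \<phi> x))\<^sup>2 \<partial>lborel)
      \<le> (\<integral>x. (norm (G x))\<^sup>2 \<partial>lebesgue_on \<Omega>) / t
        + (\<integral>x. (norm (G x - grad \<phi> x))\<^sup>2 \<partial>lebesgue_on \<Omega>) / (1 - t)"
proof -
  let ?h = "\<lambda>x. (norm (grad \<phi> x))\<^sup>2"
  have c: "continuous_on UNIV ?h" by (intro continuous_intros continuous_on_grad[OF \<phi>])
  have ind: "(\<lambda>x. indicator \<Omega> x *\<^sub>R ?h x) = ?h"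
    using grad_eq_0[OF \<phi>] by (auto simp: indicator_def fun_eq_iff)
  have "set_integrable lborel \<Omega> ?h"
    using \<Omega> c by (intro set_integrable_bounded_continuous) auto
  then show "integrable lborel ?h" unfolding set_integrable_def ind .
  have s: "square_integrable \<Omega> (grad \<phi>)"
    by (rule square_integrable_continuous[OF continuous_on_grad[OF \<phi>] \<Omega>(2,1)])
  have "(\<integral>x. ?h x \<partial>lborel) = (\<integral>x. ?h x \<partial>lebesgue_on \<Omega>)"
    using \<Omega> c by (subst integrable_lebesgue_on_iff)
      (auto simp: set_lebesgue_integral_def ind[simplified] intro: borel_measurable_continuous_onI)
  also have "\<dots> \<le> (\<integral>x. (norm (G x))\<^sup>2 / t + (norm (G x - grad \<phi> x))\<^sup>2 / (1 - t) \<partial>lebesgue_on \<Omega>)"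
    using s G square_integrable_diff[OF G s]
    by (intro integral_mono norm_square_split t) (auto simp: square_integrable_def)
  also have "\<dots> = (\<integral>x. (norm (G x))\<^sup>2 \<partial>lebesgue_on \<Omega>) / t
        + (\<integral>x. (norm (G x - grad \<phi> x))\<^sup>2 \<partial>lebesgue_on \<Omega>) / (1 - t)"
    using G square_integrable_diff[OF G s]
    by (subst Bochner_Integration.integral_add) (auto simp: square_integrable_def)
  finally show "(\<integral>x. ?h x \<partial>lborel) \<le> \<dots>" .
qed

text \<open>Approximation from inside, so that the Borel sets inherit both the inclusion in
  \<open>\<Omega>\<close> and the separation.\<close>

lemma lebesgue_inner_borel:
  assumes "S \<in> sets lebesgue"
  obtains C where "C \<in> sets borel" "C \<subseteq> S" "S - C \<in> null_sets lebesgue"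
proof -
  obtain C T where C: "fsigma C" "T \<in> null_sets lebesgue" "C \<union> T = S" "disjnt C T"
    using lebesgue_set_almost_fsigma[OF assms] .
  have "C \<in> sets borel"
    using C(1) by (auto elim!: fsigma.cases intro!: sets.countable_UN)
  moreover have "S - C = T" using C(3,4) by (auto simp: disjnt_def)
  ultimately show thesis using C that[of C] by auto
qed

text \<open>The final \<open>+ 1\<close> absorbs the gradient error of the approximating test
  function.\<close>

definition moser_const :: "nat \<Rightarrow> real \<Rightarrow> real \<Rightarrow> real \<Rightarrow> real" where
  "moser_const n t R d = n * (gibbs_const t R + n * cross_const t R d) + 1"

text \<open>The numbers \<open>z i\<close> below the integrals spare a case distinction: exponential integrability is not
  known beforehand and follows from this bound.\<close>

lemma H10_moser_trudinger:
  fixes \<Omega> :: "(real^2) set" and S :: "'i \<Rightarrow> (real^2) set"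
  assumes \<Omega>: "open \<Omega>" "bounded \<Omega>" "\<And>x. x \<in> \<Omega> \<Longrightarrow> \<Omega> \<subseteq> cball x R" "R > 0"
    and u: "u \<in> H10 \<Omega>"
    and I: "finite I"
    and S: "\<And>i. i \<in> I \<Longrightarrow> S i \<in> sets lebesgue" "\<And>i. i \<in> I \<Longrightarrow> S i \<subseteq> \<Omega>"
    and sep: "\<And>i j x y. i \<in> I \<Longrightarrow> j \<in> I \<Longrightarrow> i \<noteq> j \<Longrightarrow> x \<in> S i \<Longrightarrow> y \<in> S j \<Longrightarrow> d \<le> dist x y"
    and "d > 0"
    and z: "\<And>i. i \<in> I \<Longrightarrow> 0 < z i"
      "\<And>i. i \<in> I \<Longrightarrow> ennreal (z i) < (\<integral>\<^sup>+x. ennreal (exp (s * u x)) \<partial>lebesgue_on (S i))"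
    and t: "0 < t" "t < 1"
  shows "(\<Sum>i\<in>I. ln (z i))
    \<le> s\<^sup>2 / (16 * pi * t\<^sup>2) * (\<integral>x. (norm (weak_gradient \<Omega> u x))\<^sup>2 \<partial>lebesgue_on \<Omega>)
      + moser_const (card I) t R d"
proof -
  let ?G = "weak_gradient \<Omega> u"
  obtain \<phi> where \<phi>: "\<And>n. \<phi> n \<in> test_functions \<Omega>"
    and ae: "AE x in lebesgue. x \<in> \<Omega> \<longrightarrow> (\<lambda>n. \<phi> n x) \<longlonglongrightarrow> u x"
    and lim: "(\<lambda>n. \<integral>x. (norm (?G x - grad (\<phi> n) x))\<^sup>2 \<partial>lebesgue_on \<Omega>) \<longlonglongrightarrow> 0"
    and "square_integrable \<Omega> u" and sq: "square_integrable \<Omega> ?G"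
    by (rule H10_approximation[OF \<Omega>(1,2) u]) (rule that, assumption+)
  have "\<forall>i\<in>I. \<exists>C. C \<in> sets borel \<and> C \<subseteq> S i \<and> S i - C \<in> null_sets lebesgue"
    using lebesgue_inner_borel[OF S(1)] by metis
  then obtain C where C: "\<And>i. i \<in> I \<Longrightarrow> C i \<in> sets borel" "\<And>i. i \<in> I \<Longrightarrow> C i \<subseteq> S i"
    "\<And>i. i \<in> I \<Longrightarrow> S i - C i \<in> null_sets lebesgue"
    by metis
  have bdd: "bounded (C i)" if "i \<in> I" for i
    using C(2)[OF that] S(2)[OF that] \<Omega>(2) by (meson bounded_subset)
  have contf: "continuous_on UNIV (\<lambda>x. s * \<phi> n x)" for n
    by (intro continuous_intros continuous_on_test_function[OF \<phi>])
  have conte: "continuous_on UNIV (\<lambda>x. exp (s * \<phi> n x))" for n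
    by (intro continuous_intros contf)
  \<comment> \<open>Fatou's lemma: a number strictly below the integral for \<open>u\<close> is
    eventually below the integrals for \<open>\<phi> n\<close>. Passing from \<open>S i\<close> to
    \<open>C i\<close> loses only a null set.\<close>
  have ev: "\<forall>\<^sub>F n in sequentially. z i < (LINT x:C i|lborel. exp (s * \<phi> n x))" if i: "i \<in> I" for i
  proof -
    have m: "(\<lambda>x. ennreal (exp (s * \<phi> n x)) * indicator (C i) x) \<in> borel_measurable lborel" for n
      using borel_measurable_continuous_onI[OF conte[of n]] C(1)[OF i] by simp
    have Zn: "(\<integral>\<^sup>+x. ennreal (exp (s * \<phi> n x)) * indicator (C i) x \<partial>lebesgue)
        = ennreal (LINT x:C i|lborel. exp (s * \<phi> n x))" for n
    proof -
      have "set_integrable lborel (C i) (\<lambda>x. exp (s * \<phi> n x))"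
        using conte bdd[OF i] C(1)[OF i] by (intro set_integrable_bounded_continuous)
      then have "(\<integral>\<^sup>+x. ennreal (indicator (C i) x *\<^sub>R exp (s * \<phi> n x)) \<partial>lborel)
          = ennreal (LINT x:C i|lborel. exp (s * \<phi> n x))"
        unfolding set_integrable_def set_lebesgue_integral_def
        by (rule nn_integral_eq_integral) simp
      then show ?thesis
        by (simp add: nn_integral_completion ennreal_mult' ennreal_indicator mult.commute)
    qed
    have "ennreal (z i) < (\<integral>\<^sup>+x. ennreal (exp (s * u x)) * indicator (S i) x \<partial>lebesgue)"
      using z(2)[OF i] S(1)[OF i] by (subst (asm) nn_integral_restrict_space) auto
    also have "\<dots> \<le> (\<integral>\<^sup>+x. liminf (\<lambda>n. ennreal (exp (s * \<phi> n x)) * indicator (C i) x) \<partial>lebesgue)"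
    proof (rule nn_integral_mono_AE)
      show "AE x in lebesgue. ennreal (exp (s * u x)) * indicator (S i) x
          \<le> liminf (\<lambda>n. ennreal (exp (s * \<phi> n x)) * indicator (C i) x)"
        using ae AE_not_in[OF C(3)[OF i]]
      proof eventually_elim
        fix x assume x: "x \<in> \<Omega> \<longrightarrow> (\<lambda>n. \<phi> n x) \<longlonglongrightarrow> u x" "x \<notin> S i - C i"
        show "ennreal (exp (s * u x)) * indicator (S i) x
          \<le> liminf (\<lambda>n. ennreal (exp (s * \<phi> n x)) * indicator (C i) x)"
        proof (cases "x \<in> S i")
          case True
          then have "(\<lambda>n. \<phi> n x) \<longlonglongrightarrow> u x" "x \<in> C i" using x S(2)[OF i] by auto
          then have "(\<lambda>n. ennreal (exp (s * \<phi> n x))) \<longlonglongrightarrow> ennreal (exp (s * u x))"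
            by (intro tendsto_ennrealI tendsto_intros)
          then have "liminf (\<lambda>n. ennreal (exp (s * \<phi> n x))) = ennreal (exp (s * u x))"
            by (intro lim_imp_Liminf) auto
          then show ?thesis using True \<open>x \<in> C i\<close> by simp
        qed simp
      qed
    qed
    also have "\<dots> \<le> liminf (\<lambda>n. \<integral>\<^sup>+x. ennreal (exp (s * \<phi> n x)) * indicator (C i) x \<partial>lebesgue)"
      by (intro nn_integral_liminf measurable_completion m)
    finally have "\<forall>\<^sub>F n in sequentially. ennreal (z i) < (\<integral>\<^sup>+x. ennreal (exp (s * \<phi> n x)) * indicator (C i) x \<partial>lebesgue)"
      by (rule less_LiminfD)
    then show ?thesis
      unfolding Zn using z(1)[OF i] by (auto elim!: eventually_mono simp: ennreal_less_iff)
  qed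
  have "(\<lambda>n. s\<^sup>2 / (16 * pi * t * (1 - t)) * (\<integral>x. (norm (?G x - grad (\<phi> n) x))\<^sup>2 \<partial>lebesgue_on \<Omega>)) \<longlonglongrightarrow> s\<^sup>2 / (16 * pi * t * (1 - t)) * 0"
    by (intro tendsto_intros lim)
  then have "\<forall>\<^sub>F n in sequentially. s\<^sup>2 / (16 * pi * t * (1 - t)) * (\<integral>x. (norm (?G x - grad (\<phi> n) x))\<^sup>2 \<partial>lebesgue_on \<Omega>) < 1"
    by (rule order_tendstoD) simp
  moreover have "\<forall>\<^sub>F n in sequentially. \<forall>i\<in>I. z i < (LINT x:C i|lborel. exp (s * \<phi> n x))"
    using I ev by (simp add: eventually_ball_finite)
  ultimately have "\<exists>n. s\<^sup>2 / (16 * pi * t * (1 - t)) * (\<integral>x. (norm (?G x - grad (\<phi> n) x))\<^sup>2 \<partial>lebesgue_on \<Omega>) < 1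
      \<and> (\<forall>i\<in>I. z i < (LINT x:C i|lborel. exp (s * \<phi> n x)))"
    by (intro eventually_happens'[OF sequentially_bot] eventually_conj)
  then obtain n where n: "s\<^sup>2 / (16 * pi * t * (1 - t)) * (\<integral>x. (norm (?G x - grad (\<phi> n) x))\<^sup>2 \<partial>lebesgue_on \<Omega>) < 1"
      and zn: "\<And>i. i \<in> I \<Longrightarrow> z i < (LINT x:C i|lborel. exp (s * \<phi> n x))"
    by auto
  have deriv: "((\<lambda>x. s * \<phi> n x) has_derivative (\<lambda>h. (s *\<^sub>R grad (\<phi> n) x) \<bullet> h)) (at x)" for x
    using has_derivative_mult_right[OF test_function_derivative[OF \<phi>, of n x], of s] by simp
  have "bounded {x. \<phi> n x \<noteq> 0}"
    using \<phi>[of n] closure_subset by (auto simp: test_functions_def intro: bounded_subset[OF compact_imp_bounded])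
  then have supp: "bounded {x. s * \<phi> n x \<noteq> 0}"
    by (rule bounded_subset) auto
  note en = grad_energy_le[OF \<Omega>(1,2) \<phi>[of n] sq t]
  have norm_s: "(norm (s *\<^sub>R grad (\<phi> n) x))\<^sup>2 = s\<^sup>2 * (norm (grad (\<phi> n) x))\<^sup>2" for x
    by (simp add: power_mult_distrib)
  have "(\<Sum>i\<in>I. ln (z i)) \<le> (\<Sum>i\<in>I. ln (LINT x:C i|lborel. exp (s * \<phi> n x)))"
  proof (rule sum_mono)
    fix i assume "i \<in> I"
    then show "ln (z i) \<le> ln (LINT x:C i|lborel. exp (s * \<phi> n x))"
      using z(1)[of i] zn[of i] by (intro ln_mono) auto
  qed
  also have "\<dots> \<le> 1 / (16 * pi * t) * (\<integral>x. (norm (s *\<^sub>R grad (\<phi> n) x))\<^sup>2 \<partial>lborel)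
      + card I * (gibbs_const t R + card I * cross_const t R d)"
  proof (rule moser_trudinger_separated[OF deriv _ supp _ _ _ \<Omega>(3,4) I C(1) _ _ \<open>d > 0\<close> _ t])
    show "continuous_on UNIV (\<lambda>x. s *\<^sub>R grad (\<phi> n) x)"
      by (intro continuous_intros continuous_on_grad[OF \<phi>])
    show "s *\<^sub>R grad (\<phi> n) x = 0" if "x \<notin> \<Omega>" for x using grad_eq_0[OF \<phi> that] by simp
    show "integrable lborel (\<lambda>x. (norm (s *\<^sub>R grad (\<phi> n) x))\<^sup>2)"
      unfolding norm_s using en(1) by simp
    show "\<Omega> \<in> sets borel" using \<Omega>(1) by simp
    show "C i \<subseteq> \<Omega>" if "i \<in> I" for i using C(2)[OF that] S(2)[OF that] by auto
    show "d \<le> dist x y" if "i \<in> I" "j \<in> I" "i \<noteq> j" "x \<in> C i" "y \<in> C j" for i j x y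
      using sep[OF that(1-3)] C(2) that by blast
    show "(LINT x:C i|lborel. exp (s * \<phi> n x)) > 0" if "i \<in> I" for i
      using z(1)[OF that] zn[OF that] by simp
  qed
  \<comment> \<open>One factor \<open>1 / t\<close> is already present from Young's inequality, the
    second comes from \<open>grad_energy_le\<close>. The remaining error is below 1 by the choice of
    \<open>n\<close>.\<close>
  also have "1 / (16 * pi * t) * (\<integral>x. (norm (s *\<^sub>R grad (\<phi> n) x))\<^sup>2 \<partial>lborel)
      \<le> s\<^sup>2 / (16 * pi * t\<^sup>2) * (\<integral>x. (norm (?G x))\<^sup>2 \<partial>lebesgue_on \<Omega>) + 1"
  proof -
    have "1 / (16 * pi * t) * (\<integral>x. (norm (s *\<^sub>R grad (\<phi> n) x))\<^sup>2 \<partial>lborel)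
       = s\<^sup>2 / (16 * pi * t) * (\<integral>x. (norm (grad (\<phi> n) x))\<^sup>2 \<partial>lborel)"
      unfolding norm_s by simp
    also have "\<dots> \<le> s\<^sup>2 / (16 * pi * t) * ((\<integral>x. (norm (?G x))\<^sup>2 \<partial>lebesgue_on \<Omega>) / t
        + (\<integral>x. (norm (?G x - grad (\<phi> n) x))\<^sup>2 \<partial>lebesgue_on \<Omega>) / (1 - t))"
      using t by (intro mult_left_mono en(2)) auto
    also have "\<dots> = s\<^sup>2 / (16 * pi * t\<^sup>2) * (\<integral>x. (norm (?G x))\<^sup>2 \<partial>lebesgue_on \<Omega>)
        + s\<^sup>2 / (16 * pi * t * (1 - t)) * (\<integral>x. (norm (?G x - grad (\<phi> n) x))\<^sup>2 \<partial>lebesgue_on \<Omega>)"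
      by (simp add: distrib_left power2_eq_square mult_ac)
    finally show ?thesis using n by linarith
  qed
  finally show ?thesis by (simp add: moser_const_def)
qed

text \<open>If the integral exceeded \<open>exp (M + 1)\<close>, that number would be an admissible
  \<open>z\<close>, and the bound would read \<open>M + 1 \<le> M\<close>. Positivity holds because
  a nonempty open set is not null.\<close>

lemma H10_exp_integrable:
  fixes \<Omega> :: "(real^2) set"
  assumes \<Omega>: "open \<Omega>" "bounded \<Omega>" "\<And>x. x \<in> \<Omega> \<Longrightarrow> \<Omega> \<subseteq> cball x R" "R > 0" "\<Omega> \<noteq> {}"
    and u: "u \<in> H10 \<Omega>"
  shows "integrable (lebesgue_on \<Omega>) (\<lambda>x. exp (s * u x))"
    and "0 < (\<integral>x. exp (s * u x) \<partial>lebesgue_on \<Omega>)"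
proof -
  have um: "u \<in> borel_measurable (lebesgue_on \<Omega>)"
    by (rule H10_approximation[OF \<Omega>(1,2) u]) (simp add: square_integrable_def)
  define M where "M = s\<^sup>2 / (16 * pi * (1/2)\<^sup>2) * (\<integral>x. (norm (weak_gradient \<Omega> u x))\<^sup>2 \<partial>lebesgue_on \<Omega>)
      + moser_const 1 (1/2) R 1"
  have "(\<integral>\<^sup>+x. ennreal (exp (s * u x)) \<partial>lebesgue_on \<Omega>) \<le> ennreal (exp (M + 1))"
  proof (rule ccontr)
    assume "\<not> ?thesis"
    then have "(\<Sum>i\<in>{()}. ln (exp (M + 1))) \<le> M"
      unfolding M_def
      using H10_moser_trudinger[OF \<Omega>(1-4) u, where I = "{()}" and S = "\<lambda>_. \<Omega>" and d = 1 and z = "\<lambda>_. exp (M + 1)" and t = "1/2" and s = s] \<Omega>(1)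
      by (simp add: not_le M_def)
    then show False by simp
  qed
  then have "(\<integral>\<^sup>+x. ennreal (exp (s * u x)) \<partial>lebesgue_on \<Omega>) < \<infinity>"
    by (rule le_less_trans) simp
  then show int: "integrable (lebesgue_on \<Omega>) (\<lambda>x. exp (s * u x))"
    using um by (intro integrableI_nonneg) auto
  have "emeasure (lebesgue_on \<Omega>) (space (lebesgue_on \<Omega>)) \<noteq> 0"
    using \<Omega> open_not_negligible[of \<Omega>]
    by (auto simp: emeasure_restrict_space negligible_iff_emeasure0)
  then have "\<not> (AE x in lebesgue_on \<Omega>. exp (s * u x) = 0)"
    by (simp add: AE_iff_measurable[OF sets.top])
  moreover have "(\<integral>x. exp (s * u x) \<partial>lebesgue_on \<Omega>) \<ge> 0" by simp
  ultimately show "0 < (\<integral>x. exp (s * u x) \<partial>lebesgue_on \<Omega>)"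
    using integral_nonneg_eq_0_iff_AE[OF int] by (simp add: order_less_le)
qed

section \<open>The lower bound on the spread class\<close>

theorem lemma3p1:
  fixes \<Omega> :: "(real^2) set" and \<gamma> \<sigma> lam a0 d0 :: real
  assumes "smooth_bounded_domain \<Omega>"
    and "-1 \<le> \<gamma>" and "\<gamma> < 1" and "\<sigma> > 0" and "lam > 0"
    and "a0 > 0" and "d0 > 0"
    and "lam < 16 * pi / (1 + 2 * \<sigma> * \<gamma>\<^sup>2)"
  shows "bdd_below (J \<Omega> \<gamma> \<sigma> lam ` spread_class \<Omega> a0 d0)"
proof -
  have \<Omega>: "open \<Omega>" "bounded \<Omega>" "\<Omega> \<noteq> {}"
    using assms(1) by (auto simp: smooth_bounded_domain_def)
  obtain B where B: "B > 0" "\<And>x. x \<in> \<Omega> \<Longrightarrow> norm x \<le> B"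
    using \<Omega>(2) bounded_pos by metis
  define R where "R = 2 * B"
  have R: "R > 0" "\<And>x. x \<in> \<Omega> \<Longrightarrow> \<Omega> \<subseteq> cball x R"
  proof -
    show "\<Omega> \<subseteq> cball x R" if "x \<in> \<Omega>" for x
    proof
      fix y assume "y \<in> \<Omega>"
      then show "y \<in> cball x R"
        using B(2)[OF that] B(2)[of y] norm_triangle_ineq4[of x y] by (simp add: dist_norm R_def)
    qed
  qed (use B in \<open>simp add: R_def\<close>)
  have q: "1 + 2 * \<sigma> * \<gamma>\<^sup>2 > 0" using \<open>\<sigma> > 0\<close> by (intro add_pos_nonneg) auto
  \<comment> \<open>The hypothesis on \<open>lam\<close> says precisely that
    \<open>L < 1\<close>.\<close>
  define L where "L = lam * (1 + 2 * \<sigma> * \<gamma>\<^sup>2) / (16 * pi)"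
  have L: "0 < L" "L < 1"
  proof -
    show "0 < L" using \<open>lam > 0\<close> q unfolding L_def by (intro divide_pos_pos mult_pos_pos) auto
    show "L < 1" using assms(8) q by (simp add: L_def pos_less_divide_eq)
  qed
  \<comment> \<open>The midpoint of \<open>L\<close> and 1 satisfies
    \<open>L \<le> t\<^sup>2\<close>, because the difference is the square of
    \<open>(1 - L) / 2\<close>.\<close>
  define t where "t = (1 + L) / 2"
  have t: "0 < t" "t < 1" using L by (auto simp: t_def)
  have "L \<le> t\<^sup>2"
    using zero_le_power2[of "1 - L"] by (simp add: t_def power2_eq_square field_simps)
  define C1 where "C1 = moser_const 1 t R 1"
  define C2 where "C2 = moser_const 2 t R d0"
  have bound: "J \<Omega> \<gamma> \<sigma> lam u \<ge> - (lam * (C2 / 2 - ln (a0 / 2))) - lam * \<sigma> * (C1 + ln 2)"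
    if spread: "u \<in> spread_class \<Omega> a0 d0" for u
  proof -
    obtain \<Omega>1 \<Omega>2 where u: "u \<in> H10 \<Omega>"
      and m: "\<Omega>1 \<in> sets lebesgue" "\<Omega>2 \<in> sets lebesgue" and sub: "\<Omega>1 \<subseteq> \<Omega>" "\<Omega>2 \<subseteq> \<Omega>"
      and dist: "setdist \<Omega>1 \<Omega>2 \<ge> d0"
      and mass: "(\<integral>x. exp (u x) \<partial>lebesgue_on \<Omega>1) / (\<integral>x. exp (u x) \<partial>lebesgue_on \<Omega>) \<ge> a0"
        "(\<integral>x. exp (u x) \<partial>lebesgue_on \<Omega>2) / (\<integral>x. exp (u x) \<partial>lebesgue_on \<Omega>) \<ge> a0"
      using spread by (auto simp: spread_class_def)
    define D where "D = (\<integral>x. (norm (weak_gradient \<Omega> u x))\<^sup>2 \<partial>lebesgue_on \<Omega>)"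
    define Z where "Z = (\<integral>x. exp (u x) \<partial>lebesgue_on \<Omega>)"
    define Y where "Y = (\<integral>x. exp (\<gamma> * u x) \<partial>lebesgue_on \<Omega>)"
    note int = H10_exp_integrable[OF \<Omega>(1,2) R(2,1) \<Omega>(3) u]
    have D: "D \<ge> 0" by (simp add: D_def)
    have Z: "Z > 0" using int(2)[of 1] by (simp add: Z_def)
    have Y: "Y > 0" using int(2)[of \<gamma>] by (simp add: Y_def)
    \<comment> \<open>Halving the mass bound supplies the strict inequality required of
      \<open>z\<close>.\<close>
    have half: "ennreal (a0 * Z / 2) < (\<integral>\<^sup>+x. ennreal (exp (1 * u x)) \<partial>lebesgue_on A)"
      if A: "A \<in> sets lebesgue" "A \<subseteq> \<Omega>" and "(\<integral>x. exp (u x) \<partial>lebesgue_on A) / Z \<ge> a0" for A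
    proof -
      have "integrable (lebesgue_on A) (\<lambda>x. exp (u x))"
        using set_integrable_subset[of lebesgue \<Omega> "\<lambda>x. exp (u x)" A] int(1)[of 1] A \<Omega>(1)
        by (simp add: integrable_restrict_space set_integrable_def)
      then have "(\<integral>\<^sup>+x. ennreal (exp (1 * u x)) \<partial>lebesgue_on A) = ennreal (\<integral>x. exp (u x) \<partial>lebesgue_on A)"
        by (simp add: nn_integral_eq_integral)
      moreover have "a0 * Z \<le> (\<integral>x. exp (u x) \<partial>lebesgue_on A)"
        using that(3) Z by (simp add: field_simps)
      moreover have "0 < a0 * Z" using Z \<open>a0 > 0\<close> by simp
      ultimately show ?thesis by (simp add: ennreal_less_iff)
    qed
    \<comment> \<open>The two sets are indexed by \<open>bool\<close> with the same lower bound, so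
      the sum is twice one logarithm and dividing by 2 halves the energy coefficient.\<close>
    have "(\<Sum>i\<in>(UNIV::bool set). ln (a0 * Z / 2)) \<le> 1\<^sup>2 / (16 * pi * t\<^sup>2) * D + moser_const (card (UNIV::bool set)) t R d0"
      unfolding D_def
    proof (rule H10_moser_trudinger[OF \<Omega>(1,2) R(2,1) u, where S = "\<lambda>i. if i then \<Omega>1 else \<Omega>2"])
      fix i j x y
      assume "i \<noteq> j" "x \<in> (if i then \<Omega>1 else \<Omega>2)" "y \<in> (if j then \<Omega>1 else \<Omega>2)"
      then have "setdist \<Omega>1 \<Omega>2 \<le> dist x y"
        using setdist_le_dist[of x \<Omega>1 y \<Omega>2] setdist_le_dist[of y \<Omega>1 x \<Omega>2]
        by (auto simp: dist_commute split: if_splits)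
      then show "d0 \<le> dist x y" using dist by simp
    qed (use m sub mass half[folded Z_def] Z t \<open>a0 > 0\<close> \<open>d0 > 0\<close> in \<open>auto simp: Z_def[symmetric]\<close>)
    then have "2 * ln (a0 * Z / 2) \<le> D / (16 * pi * t\<^sup>2) + C2"
      by (simp add: C2_def)
    moreover have "ln (a0 * Z / 2) = ln Z + ln (a0 / 2)"
      using Z \<open>a0 > 0\<close> by (simp add: ln_mult ln_div)
    ultimately have lnZ: "ln Z \<le> D / (32 * pi * t\<^sup>2) + (C2 / 2 - ln (a0 / 2))"
      by simp
    have "(\<Sum>i\<in>{()}. ln (Y / 2)) \<le> \<gamma>\<^sup>2 / (16 * pi * t\<^sup>2) * D + moser_const (card {()}) t R 1"
      unfolding D_def
    proof (rule H10_moser_trudinger[OF \<Omega>(1,2) R(2,1) u, where S = "\<lambda>_. \<Omega>"])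
      show "ennreal (Y / 2) < (\<integral>\<^sup>+x. ennreal (exp (\<gamma> * u x)) \<partial>lebesgue_on \<Omega>)"
        using Y nn_integral_eq_integral[OF int(1)[of \<gamma>]] by (simp add: Y_def[symmetric] ennreal_less_iff)
    qed (use \<Omega>(1) Y t in auto)
    then have lnY: "ln Y \<le> \<gamma>\<^sup>2 * D / (16 * pi * t\<^sup>2) + (C1 + ln 2)"
      using Y by (simp add: C1_def ln_div)
    have "lam * ln Z + lam * \<sigma> * ln Y
      \<le> lam * (D / (32 * pi * t\<^sup>2) + (C2 / 2 - ln (a0 / 2))) + lam * \<sigma> * (\<gamma>\<^sup>2 * D / (16 * pi * t\<^sup>2) + (C1 + ln 2))"
      using lnZ lnY \<open>lam > 0\<close> \<open>\<sigma> > 0\<close> by (intro add_mono mult_left_mono) auto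
    \<comment> \<open>The energy coefficients add up to \<open>lam * (1 + 2 * \<sigma> *
      \<gamma>\<^sup>2) / (32 * pi * t\<^sup>2)\<close>, half of \<open>L / t\<^sup>2\<close>. As
      this ratio is at most 1, the Dirichlet term of \<open>J\<close> absorbs them.\<close>
    also have "\<dots> = 1/2 * D * (L / t\<^sup>2) + lam * (C2 / 2 - ln (a0 / 2)) + lam * \<sigma> * (C1 + ln 2)"
      using t by (simp add: L_def field_simps)
    also have "1/2 * D * (L / t\<^sup>2) \<le> 1/2 * D * 1"
      using D t \<open>L \<le> t\<^sup>2\<close> by (intro mult_left_mono) auto
    finally show ?thesis
      unfolding J_def D_def[symmetric] Z_def[symmetric] Y_def[symmetric] by simp
  qed
  then show ?thesis by (intro bdd_belowI2)
qed

end
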